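(* Let $G$ be a profinite group, let $(A,B,C)$ be a Tate product over $G$, and let $r,s\ge0$ be integers. (1) For every $\alpha\in H^r(G,A)$ and $\beta''\in H^s(G,B'')$, $$j_*(\alpha)\cup_{\mathrm{aug}}\beta''=(-1)^r\,\alpha\cup\delta(\beta'')\quad\text{in }H^{r+s+1}(G,C),$$ where $\delta:H^s(G,B'')\to H^{s+1}(G,B')$ is the connecting homomorphism and $\cup$ is the cup product induced by $A\times B'\to C$. (2) For every $\alpha''\in H^r(G,A'')$ and $\beta\in H^s(G,B)$, $$\alpha''\cup_{\mathrm{aug}}j_*(\beta)=\delta(\alpha'')\cup\beta\quad\text{in }H^{r+s+1}(G,C),$$ where $\delta:H^r(G,A'')\to H^{r+1}(G,A')$ is the connecting homomorphism and $\cup$ is the cup product induced by $A'\times B\to C$.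
   Context: For a discrete $G$-module $A$, $C^r(G,A)$ is the group of continuous maps $G^r\to A$, with coboundary $d_rf(x_1,\ldots,x_{r+1})=x_1 f(x_2,\ldots,x_{r+1})+\sum_{i=1}^r(-1)^i f(x_1,\ldots,x_ix_{i+1},\ldots,x_{r+1})+(-1)^{r+1}f(x_1,\ldots,x_r)$; $Z^r=\ker d_r$, $B^r=\operatorname{im} d_{r-1}$, $H^r=Z^r/B^r$. A map $A\times B\to C$, $(a,b)\mapsto a\times b$, of discrete $G$-modules is $G$-bilinear if it is bilinear and $g(a\times b)=ga\times gb$. It induces the cup product $\cup:C^r(G,A)\times C^s(G,B)\to C^{r+s}(G,C)$, $(f\cup g)(x_1,\ldots,x_{r+s})=f(x_1,\ldots,x_r)\times x_1\cdots x_r\, g(x_{r+1},\ldots,x_{r+s})$, and on cohomology $[f]\cup[g]=[f\cup g]$. A Tate product $(A,B,C)$ over $G$ consists of two short exact sequences of discrete $G$-modules $0\to A'\xrightarrow{i}A\xrightarrow{j}A''\to0$ and $0\to B'\xrightarrow{i}B\xrightarrow{j}B''\to0$, a discrete $G$-module $C$, and two $G$-bilinear maps $A'\times B\to C$ and $A\times B'\to C$ that coincide on $A'\times B'$. One identifies $C^r(G,A')$ with $\ker(j_*:C^r(G,A)\to C^r(G,A''))$, and similarly for $B'$. Augmented cup product $\cup_{\mathrm{aug}}:H^r(G,A'')\times H^s(G,B'')\to H^{r+s+1}(G,C)$: given $\alpha'',\beta''$, choose $f\in C^r(G,A)$, $g\in C^s(G,B)$ with $j_*f,j_*g$ cocycles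 representing $\alpha'',\beta''$; then $d_rf\in C^{r+1}(G,A')$, $d_sg\in C^{s+1}(G,B')$, and $\alpha''\cup_{\mathrm{aug}}\beta''=[d_rf\cup g+(-1)^rf\cup d_sg]$ (well defined). Connecting homomorphism: $\delta(\alpha'')=[d_rf]\in H^{r+1}(G,A')$, where $f\in C^r(G,A)$ is any cochain with $j_*f$ a cocycle representing $\alpha''$; similarly for $B$. *)

theory Defs
  imports
    "HOL-Analysis.Analysis"
    "HOL-Algebra.FiniteProduct"
    "HOL-Algebra.Group_Action"
    "HOL-Algebra.Elementary_Groups"
begin

text \<open>
  All groups are HOL-Algebra groups with explicit carriers; abelian coefficient groups are therefore
  written multiplicatively. A sign \<open>(-1)^i\<close> in front of a module element, cochain or class
  becomes the exponent \<open>[^] ((-1)^i :: int)\<close>.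
\<close>

section \<open>Profinite groups and discrete modules\<close>

definition topological_group :: "('g, 'm) monoid_scheme \<Rightarrow> 'g topology \<Rightarrow> bool" where
  "topological_group G T \<longleftrightarrow>
     group G \<and> topspace T = carrier G \<and>
     continuous_map (prod_topology T T) T (\<lambda>(x, y). x \<otimes>\<^bsub>G\<^esub> y) \<and>
     continuous_map T T (\<lambda>x. inv\<^bsub>G\<^esub> x)"

definition profinite_group :: "('g, 'm) monoid_scheme \<Rightarrow> 'g topology \<Rightarrow> bool" where
  "profinite_group G T \<longleftrightarrow>
     topological_group G T \<and> compact_space T \<and> Hausdorff_space T \<and>
     (\<forall>x\<in>topspace T. connected_component_of_set T x = {x})"

record ('g, 'a) gmodule = "'a monoid" +
  act :: "'g \<Rightarrow> 'a \<Rightarrow> 'a"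

text \<open>
  The library's \<open>group_action\<close> makes \<open>act A g\<close> an extensional bijection of the carrier.
\<close>

definition discrete_gmodule ::
    "('g, 'm) monoid_scheme \<Rightarrow> 'g topology \<Rightarrow> ('g, 'a) gmodule \<Rightarrow> bool" where
  "discrete_gmodule G T A \<longleftrightarrow>
     comm_group A \<and> group_action G (carrier A) (act A) \<and>
     (\<forall>g\<in>carrier G. act A g \<in> hom A A) \<and>
     continuous_map (prod_topology T (discrete_topology (carrier A)))
       (discrete_topology (carrier A)) (\<lambda>(g, a). act A g a)"

definition gmodule_hom ::
    "('g, 'm) monoid_scheme \<Rightarrow> ('g, 'a) gmodule \<Rightarrow> ('g, 'b) gmodule \<Rightarrow> ('a \<Rightarrow> 'b) set" where
  "gmodule_hom G A B =
     {h \<in> hom A B. \<forall>g\<in>carrier G. \<forall>a\<in>carrier A. h (act A g a) = act B g (h a)}"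

definition short_exact_gmodules ::
    "('g, 'm) monoid_scheme \<Rightarrow> 'g topology \<Rightarrow> ('g, 'a1) gmodule \<Rightarrow> ('g, 'a) gmodule \<Rightarrow>
     ('g, 'a2) gmodule \<Rightarrow> ('a1 \<Rightarrow> 'a) \<Rightarrow> ('a \<Rightarrow> 'a2) \<Rightarrow> bool" where
  "short_exact_gmodules G T A' A A'' i j \<longleftrightarrow>
     discrete_gmodule G T A' \<and> discrete_gmodule G T A \<and> discrete_gmodule G T A'' \<and>
     i \<in> gmodule_hom G A' A \<and> j \<in> gmodule_hom G A A'' \<and>
     i \<in> mon A' A \<and> j \<in> epi A A'' \<and> kernel A A'' j = i ` carrier A'"

definition G_bilinear ::
    "('g, 'm) monoid_scheme \<Rightarrow> ('g, 'a) gmodule \<Rightarrow> ('g, 'b) gmodule \<Rightarrow> ('g, 'c) gmodule \<Rightarrow>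
     ('a \<Rightarrow> 'b \<Rightarrow> 'c) \<Rightarrow> bool" where
  "G_bilinear G A B C p \<longleftrightarrow>
     (\<forall>b\<in>carrier B. (\<lambda>a. p a b) \<in> hom A C) \<and>
     (\<forall>a\<in>carrier A. (\<lambda>b. p a b) \<in> hom B C) \<and>
     (\<forall>g\<in>carrier G. \<forall>a\<in>carrier A. \<forall>b\<in>carrier B.
        act C g (p a b) = p (act A g a) (act B g b))"

text \<open>
  Here \<open>p\<close> is the pairing \<open>A' \<times> B \<rightarrow> C\<close> and \<open>q\<close> the pairing \<open>A \<times> B' \<rightarrow> C\<close>.
\<close>

definition tate_product ::
    "('g, 'm) monoid_scheme \<Rightarrow> 'g topology \<Rightarrow>
     ('g, 'a1) gmodule \<Rightarrow> ('g, 'a) gmodule \<Rightarrow> ('g, 'a2) gmodule \<Rightarrow> ('a1 \<Rightarrow> 'a) \<Rightarrow> ('a \<Rightarrow> 'a2) \<Rightarrow>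
     ('g, 'b1) gmodule \<Rightarrow> ('g, 'b) gmodule \<Rightarrow> ('g, 'b2) gmodule \<Rightarrow> ('b1 \<Rightarrow> 'b) \<Rightarrow> ('b \<Rightarrow> 'b2) \<Rightarrow>
     ('g, 'c) gmodule \<Rightarrow> ('a1 \<Rightarrow> 'b \<Rightarrow> 'c) \<Rightarrow> ('a \<Rightarrow> 'b1 \<Rightarrow> 'c) \<Rightarrow> bool" where
  "tate_product G T A' A A'' iA jA B' B B'' iB jB C p q \<longleftrightarrow>
     short_exact_gmodules G T A' A A'' iA jA \<and>
     short_exact_gmodules G T B' B B'' iB jB \<and>
     discrete_gmodule G T C \<and>
     G_bilinear G A' B C p \<and> G_bilinear G A B' C q \<and>
     (\<forall>a\<in>carrier A'. \<forall>b\<in>carrier B'. p a (iB b) = q (iA a) b)"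


section \<open>Continuous cochains and cohomology\<close>

text \<open>
  A point of \<open>G^r\<close> is an extensional function on \<open>{..<r}\<close>, so \<open>x k\<close> is the entry that is
  usually written with index \<open>k + 1\<close>.
\<close>

definition gtuples :: "('g, 'm) monoid_scheme \<Rightarrow> nat \<Rightarrow> (nat \<Rightarrow> 'g) set" where
  "gtuples G r = {..<r} \<rightarrow>\<^sub>E carrier G"

text \<open>
  Cochains are extensional on \<open>G^r\<close>, so that equality of cochains is equality of functions.
\<close>

definition cochains ::
    "('g, 'm) monoid_scheme \<Rightarrow> 'g topology \<Rightarrow> nat \<Rightarrow> ('g, 'a) gmodule \<Rightarrow> ((nat \<Rightarrow> 'g) \<Rightarrow> 'a) monoid"
  where
  "cochains G T r A =
     \<lparr>carrier = {f \<in> extensional (gtuples G r).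
        continuous_map (product_topology (\<lambda>_. T) {..<r}) (discrete_topology (carrier A)) f},
      mult = (\<lambda>f h. \<lambda>x\<in>gtuples G r. f x \<otimes>\<^bsub>A\<^esub> h x),
      one = (\<lambda>x\<in>gtuples G r. \<one>\<^bsub>A\<^esub>)\<rparr>"

text \<open>
  \<open>contract G r i\<close> sends \<open>(x_1, ..., x_{r+1})\<close> to \<open>(x_1, ..., x_i x_{i+1}, ..., x_{r+1})\<close>,
  where \<open>1 \<le> i \<le> r\<close> is the usual one-based index.
\<close>

definition contract :: "('g, 'm) monoid_scheme \<Rightarrow> nat \<Rightarrow> nat \<Rightarrow> (nat \<Rightarrow> 'g) \<Rightarrow> nat \<Rightarrow> 'g" where
  "contract G r i x =
     (\<lambda>k\<in>{..<r}. if Suc k < i then x k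
                 else if Suc k = i then x k \<otimes>\<^bsub>G\<^esub> x (Suc k)
                 else x (Suc k))"

definition coboundary ::
    "('g, 'm) monoid_scheme \<Rightarrow> nat \<Rightarrow> ('g, 'a) gmodule \<Rightarrow>
     ((nat \<Rightarrow> 'g) \<Rightarrow> 'a) \<Rightarrow> (nat \<Rightarrow> 'g) \<Rightarrow> 'a" where
  "coboundary G r A f =
     (\<lambda>x\<in>gtuples G (Suc r).
        act A (x 0) (f (\<lambda>k\<in>{..<r}. x (Suc k)))
        \<otimes>\<^bsub>A\<^esub> (\<Otimes>\<^bsub>A\<^esub>i\<in>{1..r}. f (contract G r i x) [^]\<^bsub>A\<^esub> ((-1) ^ i :: int))
        \<otimes>\<^bsub>A\<^esub> f (restrict x {..<r}) [^]\<^bsub>A\<^esub> ((-1) ^ Suc r :: int))"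

definition cocycles ::
    "('g, 'm) monoid_scheme \<Rightarrow> 'g topology \<Rightarrow> nat \<Rightarrow> ('g, 'a) gmodule \<Rightarrow> ((nat \<Rightarrow> 'g) \<Rightarrow> 'a) set" where
  "cocycles G T r A = kernel (cochains G T r A) (cochains G T (Suc r) A) (coboundary G r A)"

text \<open>In degree 0 the group of coboundaries is trivial, since \<open>C^{-1} = 0\<close>.\<close>

definition coboundaries ::
    "('g, 'm) monoid_scheme \<Rightarrow> 'g topology \<Rightarrow> nat \<Rightarrow> ('g, 'a) gmodule \<Rightarrow> ((nat \<Rightarrow> 'g) \<Rightarrow> 'a) set" where
  "coboundaries G T r A =
     (case r of 0 \<Rightarrow> {\<one>\<^bsub>cochains G T 0 A\<^esub>}
      | Suc q \<Rightarrow> coboundary G q A ` carrier (cochains G T q A))"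

definition cohomology ::
    "('g, 'm) monoid_scheme \<Rightarrow> 'g topology \<Rightarrow> nat \<Rightarrow> ('g, 'a) gmodule \<Rightarrow>
     ((nat \<Rightarrow> 'g) \<Rightarrow> 'a) set monoid" where
  "cohomology G T r A =
     (cochains G T r A)\<lparr>carrier := cocycles G T r A\<rparr> Mod coboundaries G T r A"

definition coclass ::
    "('g, 'm) monoid_scheme \<Rightarrow> 'g topology \<Rightarrow> nat \<Rightarrow> ('g, 'a) gmodule \<Rightarrow>
     ((nat \<Rightarrow> 'g) \<Rightarrow> 'a) \<Rightarrow> ((nat \<Rightarrow> 'g) \<Rightarrow> 'a) set" where
  "coclass G T r A f = coboundaries G T r A #>\<^bsub>cochains G T r A\<^esub> f"

definition represents ::
    "('g, 'm) monoid_scheme \<Rightarrow> 'g topology \<Rightarrow> nat \<Rightarrow> ('g, 'a) gmodule \<Rightarrow>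
     ((nat \<Rightarrow> 'g) \<Rightarrow> 'a) \<Rightarrow> ((nat \<Rightarrow> 'g) \<Rightarrow> 'a) set \<Rightarrow> bool" where
  "represents G T r A f \<alpha> \<longleftrightarrow> f \<in> cocycles G T r A \<and> coclass G T r A f = \<alpha>"

definition push ::
    "('g, 'm) monoid_scheme \<Rightarrow> nat \<Rightarrow> ('a \<Rightarrow> 'b) \<Rightarrow> ((nat \<Rightarrow> 'g) \<Rightarrow> 'a) \<Rightarrow> (nat \<Rightarrow> 'g) \<Rightarrow> 'b" where
  "push G r h f = compose (gtuples G r) h f"

text \<open>
  For an injective \<open>i : A' \<rightarrow> A\<close> and a cochain \<open>f\<close> with values in the image of \<open>i\<close>,
  \<open>pull G r A' i f\<close> is the unique \<open>A'\<close>-valued cochain whose image under \<open>i\<close> is \<open>f\<close>.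
  It realizes the identification of \<open>C^r(G,A')\<close> with the kernel of \<open>C^r(G,A) \<rightarrow> C^r(G,A'')\<close>.
\<close>

definition pull ::
    "('g, 'm) monoid_scheme \<Rightarrow> nat \<Rightarrow> ('g, 'a1) gmodule \<Rightarrow> ('a1 \<Rightarrow> 'a) \<Rightarrow>
     ((nat \<Rightarrow> 'g) \<Rightarrow> 'a) \<Rightarrow> (nat \<Rightarrow> 'g) \<Rightarrow> 'a1" where
  "pull G r A' i f = compose (gtuples G r) (inv_into (carrier A') i) f"

text \<open>
  The operations on cohomology below are specified by arbitrary choices of representatives;
  the description operator picks the common value over all choices.
\<close>

definition cohomology_map ::
    "('g, 'm) monoid_scheme \<Rightarrow> 'g topology \<Rightarrow> nat \<Rightarrow> ('g, 'a) gmodule \<Rightarrow> ('g, 'b) gmodule \<Rightarrow>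
     ('a \<Rightarrow> 'b) \<Rightarrow> ((nat \<Rightarrow> 'g) \<Rightarrow> 'a) set \<Rightarrow> ((nat \<Rightarrow> 'g) \<Rightarrow> 'b) set" where
  "cohomology_map G T r A B h \<alpha> =
     (THE \<gamma>. \<exists>f. represents G T r A f \<alpha> \<and> \<gamma> = coclass G T r B (push G r h f))"

definition connecting ::
    "('g, 'm) monoid_scheme \<Rightarrow> 'g topology \<Rightarrow> nat \<Rightarrow>
     ('g, 'a1) gmodule \<Rightarrow> ('g, 'a) gmodule \<Rightarrow> ('g, 'a2) gmodule \<Rightarrow> ('a1 \<Rightarrow> 'a) \<Rightarrow> ('a \<Rightarrow> 'a2) \<Rightarrow>
     ((nat \<Rightarrow> 'g) \<Rightarrow> 'a2) set \<Rightarrow> ((nat \<Rightarrow> 'g) \<Rightarrow> 'a1) set" where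
  "connecting G T r A' A A'' i j \<alpha> =
     (THE \<gamma>. \<exists>f\<in>carrier (cochains G T r A).
        represents G T r A'' (push G r j f) \<alpha> \<and>
        \<gamma> = coclass G T (Suc r) A' (pull G (Suc r) A' i (coboundary G r A f)))"


section \<open>Cup products\<close>

primrec initial_prod :: "('g, 'm) monoid_scheme \<Rightarrow> nat \<Rightarrow> (nat \<Rightarrow> 'g) \<Rightarrow> 'g" where
  "initial_prod G 0 x = \<one>\<^bsub>G\<^esub>"
| "initial_prod G (Suc r) x = initial_prod G r x \<otimes>\<^bsub>G\<^esub> x r"

definition cup ::
    "('g, 'm) monoid_scheme \<Rightarrow> nat \<Rightarrow> nat \<Rightarrow> ('g, 'b) gmodule \<Rightarrow> ('a \<Rightarrow> 'b \<Rightarrow> 'c) \<Rightarrow>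
     ((nat \<Rightarrow> 'g) \<Rightarrow> 'a) \<Rightarrow> ((nat \<Rightarrow> 'g) \<Rightarrow> 'b) \<Rightarrow> (nat \<Rightarrow> 'g) \<Rightarrow> 'c" where
  "cup G r s B p f g =
     (\<lambda>x\<in>gtuples G (r + s).
        p (f (restrict x {..<r})) (act B (initial_prod G r x) (g (\<lambda>k\<in>{..<s}. x (r + k)))))"

definition cohomology_cup ::
    "('g, 'm) monoid_scheme \<Rightarrow> 'g topology \<Rightarrow> nat \<Rightarrow> nat \<Rightarrow>
     ('g, 'a) gmodule \<Rightarrow> ('g, 'b) gmodule \<Rightarrow> ('g, 'c) gmodule \<Rightarrow> ('a \<Rightarrow> 'b \<Rightarrow> 'c) \<Rightarrow>
     ((nat \<Rightarrow> 'g) \<Rightarrow> 'a) set \<Rightarrow> ((nat \<Rightarrow> 'g) \<Rightarrow> 'b) set \<Rightarrow> ((nat \<Rightarrow> 'g) \<Rightarrow> 'c) set" where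
  "cohomology_cup G T r s A B C p \<alpha> \<beta> =
     (THE \<gamma>. \<exists>f g. represents G T r A f \<alpha> \<and> represents G T s B g \<beta> \<and>
        \<gamma> = coclass G T (r + s) C (cup G r s B p f g))"

definition aug_cup ::
    "('g, 'm) monoid_scheme \<Rightarrow> 'g topology \<Rightarrow> nat \<Rightarrow> nat \<Rightarrow>
     ('g, 'a1) gmodule \<Rightarrow> ('g, 'a) gmodule \<Rightarrow> ('g, 'a2) gmodule \<Rightarrow> ('a1 \<Rightarrow> 'a) \<Rightarrow> ('a \<Rightarrow> 'a2) \<Rightarrow>
     ('g, 'b1) gmodule \<Rightarrow> ('g, 'b) gmodule \<Rightarrow> ('g, 'b2) gmodule \<Rightarrow> ('b1 \<Rightarrow> 'b) \<Rightarrow> ('b \<Rightarrow> 'b2) \<Rightarrow>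
     ('g, 'c) gmodule \<Rightarrow> ('a1 \<Rightarrow> 'b \<Rightarrow> 'c) \<Rightarrow> ('a \<Rightarrow> 'b1 \<Rightarrow> 'c) \<Rightarrow>
     ((nat \<Rightarrow> 'g) \<Rightarrow> 'a2) set \<Rightarrow> ((nat \<Rightarrow> 'g) \<Rightarrow> 'b2) set \<Rightarrow> ((nat \<Rightarrow> 'g) \<Rightarrow> 'c) set" where
  "aug_cup G T r s A' A A'' iA jA B' B B'' iB jB C p q \<alpha> \<beta> =
     (THE \<gamma>. \<exists>f\<in>carrier (cochains G T r A). \<exists>g\<in>carrier (cochains G T s B).
        represents G T r A'' (push G r jA f) \<alpha> \<and>
        represents G T s B'' (push G s jB g) \<beta> \<and>
        \<gamma> = coclass G T (r + s + 1) C
              (cup G (Suc r) s B p (pull G (Suc r) A' iA (coboundary G r A f)) g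
               \<otimes>\<^bsub>cochains G T (r + s + 1) C\<^esub>
               cup G r (Suc s) B' q f (pull G (Suc s) B' iB (coboundary G s B g))
                 [^]\<^bsub>cochains G T (r + s + 1) C\<^esub> ((-1) ^ r :: int)))"

end

theory Submission
  imports Defs
begin

text \<open>
  For lifts \<open>f\<close>, \<open>g\<close> of two cocycles, the augmented cup product is the class of
  \<open>df \<union> g + (-1)^r f \<union> dg\<close>. If \<open>f\<close> itself is a cocycle, the first summand vanishes, and if
  \<open>g\<close> is a cocycle, the second one does; what remains is a cup product with the connecting
  homomorphism. The work lies in showing that the classes do not depend on the choices: another
  lift differs from \<open>f\<close> by a coboundary \<open>b\<close> and a cochain \<open>e\<close> with values in \<open>A'\<close>. The first
  contributes \<open>(-1)^r b \<union> dg\<close>, where \<open>dg\<close> is a cocycle. For the second, the agreement of the two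
  pairings on \<open>A' \<times> B'\<close> turns the whole expression into \<open>de \<union> g + (-1)^r e \<union> dg = d(e \<union> g)\<close>.
\<close>

section \<open>Alternating products\<close>

text \<open>The operations \<open>cohomology_map\<close>, \<open>connecting\<close>,
  \<open>cohomology_cup\<close> and \<open>aug_cup\<close> are definite descriptions: none can be
  evaluated before independence of the representatives is known. Each is therefore reduced to one
  evaluation rule on classes, after which both formulas become identities between cochains. The
  description of a change of lift rests on discreteness. Every map out of a discrete module is
  continuous, so a mere set-theoretic section of \<open>j\<close> lifts continuous cochains. A
  cocycle of \<open>A''\<close> need not lift to a cocycle of \<open>A\<close>, and \<delta>
  measures the obstruction; but a coboundary lifts to a coboundary, by lifting a cochain that it
  bounds. This is why the correction \<open>b\<close> can be taken to be a coboundary. Both dd = 0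
  and the Leibniz rule are proved at a fixed tuple, where each side is an alternating product of
  faces. The group law and the action enter only through identities between single faces; the signs
  are handled by index combinatorics in an arbitrary abelian group.\<close>

definition signed :: "('a, 'm) monoid_scheme \<Rightarrow> nat \<Rightarrow> 'a \<Rightarrow> 'a" where
  "signed A n x = x [^]\<^bsub>A\<^esub> ((-1) ^ n :: int)"

text \<open>The sum of (-1)^i a_i in multiplicative notation. The range starts at 0 so that the two
  end faces of a coboundary need no separate terms.\<close>

definition altprod :: "('a, 'm) monoid_scheme \<Rightarrow> nat \<Rightarrow> (nat \<Rightarrow> 'a) \<Rightarrow> 'a" where
  "altprod A n a = (\<Otimes>\<^bsub>A\<^esub>i\<in>{..n}. signed A i (a i))"

context comm_group
begin

lemma signed_closed [simp, intro]: "x \<in> carrier G \<Longrightarrow> signed G n x \<in> carrier G"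
  by (simp add: signed_def)

lemma signed_one [simp]: "signed G n \<one> = \<one>"
  by (simp add: signed_def)

lemma signed_0 [simp]: "x \<in> carrier G \<Longrightarrow> signed G 0 x = x"
  by (simp add: signed_def)

lemma signed_mult:
  "x \<in> carrier G \<Longrightarrow> y \<in> carrier G \<Longrightarrow> signed G n (x \<otimes> y) = signed G n x \<otimes> signed G n y"
  by (simp add: signed_def int_pow_distrib)

lemma signed_Suc: "x \<in> carrier G \<Longrightarrow> signed G (Suc n) x = inv (signed G n x)"
  by (simp add: signed_def int_pow_neg)

lemma signed_signed: "x \<in> carrier G \<Longrightarrow> signed G m (signed G n x) = signed G (m + n) x"
  by (simp add: signed_def int_pow_pow power_add mult.commute)

lemma signed_twice [simp]: "x \<in> carrier G \<Longrightarrow> signed G n (signed G n x) = x"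
  by (simp add: signed_def int_pow_pow flip: power_mult_distrib)

lemma altprod_closed [simp, intro]:
  "(\<And>i. i \<le> n \<Longrightarrow> a i \<in> carrier G) \<Longrightarrow> altprod G n a \<in> carrier G"
  by (auto simp: altprod_def)

lemma altprod_0: "a 0 \<in> carrier G \<Longrightarrow> altprod G 0 a = a 0"
  by (simp add: altprod_def)

lemma altprod_Suc:
  "(\<And>i. i \<le> Suc n \<Longrightarrow> a i \<in> carrier G) \<Longrightarrow>
    altprod G (Suc n) a = altprod G n a \<otimes> signed G (Suc n) (a (Suc n))"
  unfolding altprod_def by (subst finprod_Suc) (auto intro!: m_comm)

lemma altprod_cong:
  "(\<And>i. i \<le> n \<Longrightarrow> a i = b i) \<Longrightarrow> (\<And>i. i \<le> n \<Longrightarrow> b i \<in> carrier G) \<Longrightarrow>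
    altprod G n a = altprod G n b"
  unfolding altprod_def by (rule finprod_cong') auto

lemma altprod_mult:
  "(\<And>i. i \<le> n \<Longrightarrow> a i \<in> carrier G) \<Longrightarrow> (\<And>i. i \<le> n \<Longrightarrow> b i \<in> carrier G) \<Longrightarrow>
    altprod G n (\<lambda>i. a i \<otimes> b i) = altprod G n a \<otimes> altprod G n b"
proof (induction n)
  case 0
  then show ?case by (simp add: altprod_0)
next
  case (Suc n)
  then show ?case by (simp add: altprod_Suc signed_mult m_ac)
qed

lemma altprod_signed:
  "(\<And>i. i \<le> n \<Longrightarrow> a i \<in> carrier G) \<Longrightarrow>
    altprod G n (\<lambda>i. signed G m (a i)) = signed G m (altprod G n a)"
proof (induction n)
  case 0
  then show ?case by (simp add: altprod_0)
next
  case (Suc n)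
  then show ?case by (simp add: altprod_Suc signed_mult signed_signed add.commute)
qed

text \<open>The formal part of dd = 0: the second assumption is the cosimplicial identity, with
  \<open>j\<close> the outer and \<open>i\<close> the inner face. In the induction the last inner
  index is split off every row except the last one. The smaller array is trivial by induction; the
  column split off equals the last row by the identity at the largest \<open>j\<close>, and the two
  enter with opposite signs.\<close>

lemma altprod_cosimplicial:
  assumes "\<And>i j. j \<le> Suc n \<Longrightarrow> i \<le> n \<Longrightarrow> a j i \<in> carrier G"
    and "\<And>i j. i < j \<Longrightarrow> j \<le> Suc n \<Longrightarrow> a j i = a i (j - 1)"
  shows "altprod G (Suc n) (\<lambda>j. altprod G n (a j)) = \<one>"
  using assms
proof (induction n)
  case 0
  have "a 1 0 = a 0 0" "a 0 0 \<in> carrier G"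
    using 0(2)[of 0 1] 0(1)[of 0 0] by auto
  then show ?case
    using 0 by (simp add: altprod_Suc altprod_0 signed_Suc)
next
  case (Suc n)
  let ?t = "\<lambda>j. signed G (Suc n) (a j (Suc n))"
  have cl: "a j i \<in> carrier G" if "j \<le> Suc (Suc n)" "i \<le> Suc n" for i j
    using Suc.prems that by simp
  have IH: "altprod G (Suc n) (\<lambda>j. altprod G n (a j)) = \<one>"
    using Suc.prems by (intro Suc.IH) auto
  have "altprod G (Suc n) (\<lambda>j. altprod G (Suc n) (a j))
      = altprod G (Suc n) (\<lambda>j. altprod G n (a j) \<otimes> ?t j)"
    using cl by (intro altprod_cong altprod_Suc) auto
  also have "\<dots> = altprod G (Suc n) (\<lambda>j. altprod G n (a j)) \<otimes> altprod G (Suc n) ?t"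
    by (intro altprod_mult) (auto intro!: cl)
  also have "\<dots> = signed G (Suc n) (altprod G (Suc n) (\<lambda>j. a j (Suc n)))"
    unfolding IH using cl by (simp add: altprod_signed)
  also have "altprod G (Suc n) (\<lambda>j. a j (Suc n)) = altprod G (Suc n) (a (Suc (Suc n)))"
    using Suc.prems(2)[of _ "Suc (Suc n)"] by (intro altprod_cong) (auto intro!: cl)
  finally show ?case
    by (subst altprod_Suc) (auto intro!: cl simp: signed_Suc cl)
qed

text \<open>
  This is the bookkeeping behind the Leibniz rule: the faces of a cup product are the faces of the
  first factor followed by those of the second, and the two faces in the middle, \<open>P (Suc r)\<close>
  and \<open>Q 0\<close>, agree and enter with opposite signs.
\<close>

lemma altprod_concat:
  assumes "\<And>i. i \<le> Suc r \<Longrightarrow> P i \<in> carrier G" "\<And>i. i \<le> m \<Longrightarrow> Q i \<in> carrier G"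
    and "\<And>i. i \<le> r \<Longrightarrow> R i = P i" "\<And>t. 1 \<le> t \<Longrightarrow> t \<le> m \<Longrightarrow> R (r + t) = Q t"
    and "P (Suc r) = Q 0"
  shows "altprod G (r + m) R = altprod G (Suc r) P \<otimes> signed G r (altprod G m Q)"
  using assms
proof (induction m)
  case 0
  have "altprod G r R = altprod G r P"
    using 0 by (intro altprod_cong) auto
  moreover have "Q 0 \<in> carrier G" using 0 by auto
  ultimately show ?case
    using 0 by (simp add: altprod_Suc altprod_0 signed_Suc m_assoc)
next
  case (Suc m)
  have R: "R i \<in> carrier G" if "i \<le> r + Suc m" for i
  proof (cases "i \<le> r")
    case False
    then show ?thesis
      using Suc.prems(2)[of "i - r"] Suc.prems(4)[of "i - r"] that by simp
  qed (use Suc.prems in auto)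
  have IH: "altprod G (r + m) R = altprod G (Suc r) P \<otimes> signed G r (altprod G m Q)"
    using Suc.prems by (intro Suc.IH) auto
  have Q: "Q i \<in> carrier G" if "i \<le> Suc m" for i using Suc.prems that by auto
  have P: "altprod G (Suc r) P \<in> carrier G" using Suc.prems by auto
  have "altprod G (r + Suc m) R
      = altprod G (r + m) R \<otimes> signed G (Suc (r + m)) (R (Suc (r + m)))"
    using R by (simp add: altprod_Suc)
  also have "R (Suc (r + m)) = Q (Suc m)" using Suc.prems(4)[of "Suc m"] by simp
  finally show ?case
    unfolding IH using P Q
    by (simp add: altprod_Suc [of m] signed_mult signed_signed m_assoc)
qed

end

lemma hom_signed:
  "h \<in> hom A B \<Longrightarrow> group A \<Longrightarrow> group B \<Longrightarrow> x \<in> carrier A \<Longrightarrow> h (signed A n x) = signed B n (h x)"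
  by (simp add: signed_def hom_int_pow)

lemma hom_altprod:
  assumes "h \<in> hom A B" "comm_group A" "comm_group B" "\<And>i. i \<le> n \<Longrightarrow> a i \<in> carrier A"
  shows "h (altprod A n a) = altprod B n (\<lambda>i. h (a i))"
proof -
  interpret A: comm_group A by fact
  interpret B: comm_group B by fact
  show ?thesis
    using assms(4)
  proof (induction n)
    case 0
    then show ?case using hom_in_carrier [OF assms(1)] by (simp add: A.altprod_0 B.altprod_0)
  next
    case (Suc n)
    then show ?case using hom_in_carrier [OF assms(1)] assms(1)
      by (simp add: A.altprod_Suc B.altprod_Suc hom_mult hom_signed)
  qed
qed

section \<open>Cochains and the coboundary\<close>

text \<open>
  \<open>contract G r i\<close> is also meaningful at the ends: it drops the first entry for \<open>i = 0\<close> and the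
  last one for \<open>i = r + 1\<close>. So the coboundary is the alternating product of the faces
  \<open>0, ..., r + 1\<close>.
\<close>

definition face ::
    "('g, 'm) monoid_scheme \<Rightarrow> nat \<Rightarrow> ('g, 'a) gmodule \<Rightarrow> nat \<Rightarrow>
     ((nat \<Rightarrow> 'g) \<Rightarrow> 'a) \<Rightarrow> (nat \<Rightarrow> 'g) \<Rightarrow> 'a" where
  "face G r A i f x =
     (if i = 0 then act A (x 0) (f (contract G r i x)) else f (contract G r i x))"

lemma contract_0: "contract G r 0 x = (\<lambda>k\<in>{..<r}. x (Suc k))"
  by (simp add: contract_def)

lemma contract_Suc: "contract G r (Suc r) x = restrict x {..<r}"
  by (auto simp: contract_def)

text \<open>Continuity of \<open>h\<close> is automatic on a discrete space, so only its values
  matter. Hence inverses in \<open>A\<close>, pairings and non-canonical sections all preserve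
  continuous cochains.\<close>

lemma continuous_map_discrete_fun:
  assumes "continuous_map X (discrete_topology U) f" "\<And>u. u \<in> U \<Longrightarrow> h u \<in> V"
  shows "continuous_map X (discrete_topology V) (\<lambda>x. h (f x))"
proof -
  have "continuous_map (discrete_topology U) (discrete_topology V) h"
    using assms(2) by auto
  from continuous_map_compose [OF assms(1) this] show ?thesis by (simp add: o_def)
qed

lemma continuous_map_discrete_fun2:
  assumes "continuous_map X (discrete_topology U) f" "continuous_map X (discrete_topology V) g"
    and "\<And>u v. u \<in> U \<Longrightarrow> v \<in> V \<Longrightarrow> h u v \<in> W"
  shows "continuous_map X (discrete_topology W) (\<lambda>x. h (f x) (g x))"
proof -
  have "continuous_map X (discrete_topology (U \<times> V)) (\<lambda>x. (f x, g x))"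
    using assms(1,2) by (simp add: prod_topology_discrete_topology continuous_map_paired)
  from continuous_map_discrete_fun [OF this, of "\<lambda>(u, v). h u v" W] assms(3)
  show ?thesis by auto
qed

lemma discrete_gmodule_comm_group: "discrete_gmodule G T A \<Longrightarrow> comm_group A"
  by (simp add: discrete_gmodule_def)

lemma act_hom: "discrete_gmodule G T A \<Longrightarrow> g \<in> carrier G \<Longrightarrow> act A g \<in> hom A A"
  by (simp add: discrete_gmodule_def)

lemma act_closed:
  "discrete_gmodule G T A \<Longrightarrow> g \<in> carrier G \<Longrightarrow> a \<in> carrier A \<Longrightarrow> act A g a \<in> carrier A"
  by (meson act_hom hom_in_carrier)

lemma act_mult:
  "discrete_gmodule G T A \<Longrightarrow> g \<in> carrier G \<Longrightarrow> h \<in> carrier G \<Longrightarrow> a \<in> carrier A \<Longrightarrow>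
    act A (g \<otimes>\<^bsub>G\<^esub> h) a = act A g (act A h a)"
  unfolding discrete_gmodule_def by (metis group_action.composition_rule)

lemma gtuples_in_carrier: "x \<in> gtuples G r \<Longrightarrow> k < r \<Longrightarrow> x k \<in> carrier G"
  unfolding gtuples_def by (erule PiE_mem) simp

lemma restrict_in_gtuples: "x \<in> gtuples G n \<Longrightarrow> r \<le> n \<Longrightarrow> restrict x {..<r} \<in> gtuples G r"
  by (simp add: gtuples_def restrict_PiE_iff PiE_iff)

lemma shift_in_gtuples: "x \<in> gtuples G (r + s) \<Longrightarrow> (\<lambda>k\<in>{..<s}. x (r + k)) \<in> gtuples G s"
  by (simp add: gtuples_def restrict_PiE_iff PiE_iff)

locale topological_group_structure =
  fixes G :: "('g, 'm) monoid_scheme" and T :: "'g topology"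
  assumes topological_group: "topological_group G T"
begin

sublocale group G
  using topological_group by (simp add: topological_group_def)

lemma topspace_T: "topspace T = carrier G"
  using topological_group by (simp add: topological_group_def)

abbreviation tuples_topology :: "nat \<Rightarrow> (nat \<Rightarrow> 'g) topology" where
  "tuples_topology r \<equiv> product_topology (\<lambda>_. T) {..<r}"

lemma topspace_tuples [simp]: "topspace (tuples_topology r) = gtuples G r"
  by (simp add: gtuples_def topspace_T)

declare topspace_product_topology [simp del]

section \<open>Continuity of the operations on tuples\<close>

lemma continuous_map_group_mult:
  assumes "continuous_map X T f" "continuous_map X T g"
  shows "continuous_map X T (\<lambda>x. f x \<otimes>\<^bsub>G\<^esub> g x)"
proof -
  have "continuous_map (prod_topology T T) T (\<lambda>(x, y). x \<otimes>\<^bsub>G\<^esub> y)"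
    using topological_group by (simp add: topological_group_def)
  moreover have "continuous_map X (prod_topology T T) (\<lambda>x. (f x, g x))"
    using assms by (simp add: continuous_map_paired)
  ultimately show ?thesis
    using continuous_map_compose [of X "prod_topology T T" "\<lambda>x. (f x, g x)" T
        "\<lambda>(x, y). x \<otimes>\<^bsub>G\<^esub> y"] by (simp add: o_def)
qed

lemma continuous_map_act:
  assumes "discrete_gmodule G T A" "continuous_map X T u"
    and "continuous_map X (discrete_topology (carrier A)) f"
  shows "continuous_map X (discrete_topology (carrier A)) (\<lambda>x. act A (u x) (f x))"
proof -
  let ?Y = "prod_topology T (discrete_topology (carrier A))"
  have "continuous_map ?Y (discrete_topology (carrier A)) (\<lambda>(g, a). act A g a)"
    using assms(1) by (simp add: discrete_gmodule_def)
  moreover have "continuous_map X ?Y (\<lambda>x. (u x, f x))"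
    using assms(2,3) by (simp add: continuous_map_paired)
  ultimately show ?thesis
    using continuous_map_compose [of X ?Y "\<lambda>x. (u x, f x)" _ "\<lambda>(g, a). act A g a"]
    by (simp add: o_def)
qed

lemma continuous_map_coord: "k < r \<Longrightarrow> continuous_map (tuples_topology r) T (\<lambda>x. x k)"
  by (rule continuous_map_product_projection) simp

lemma continuous_map_into_tuples:
  assumes "\<And>k. k < r \<Longrightarrow> continuous_map X T (\<lambda>x. u x k)"
  shows "continuous_map X (tuples_topology r) (\<lambda>x. \<lambda>k\<in>{..<r}. u x k)"
  using assms by (auto simp: continuous_map_componentwise)

lemma continuous_map_contract:
  "continuous_map (tuples_topology (Suc r)) (tuples_topology r) (contract G r i)"
proof -
  have "continuous_map (tuples_topology (Suc r)) T
      (\<lambda>x. if Suc k < i then x k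
           else if Suc k = i then x k \<otimes>\<^bsub>G\<^esub> x (Suc k) else x (Suc k))"
    if "k < r" for k
    using that by (auto intro!: continuous_map_coord continuous_map_group_mult)
  from continuous_map_into_tuples [OF this] show ?thesis
    unfolding contract_def [abs_def] .
qed

lemma continuous_map_initial_prod:
  "n \<le> r \<Longrightarrow> continuous_map (tuples_topology r) T (initial_prod G n)"
proof (induction n)
  case 0
  then show ?case by (simp add: topspace_T)
next
  case (Suc n)
  then show ?case
    by (auto intro!: continuous_map_group_mult continuous_map_coord)
qed

section \<open>Identities between contractions and initial products\<close>

lemma initial_prod_closed [simp]:
  "x \<in> gtuples G r \<Longrightarrow> n \<le> r \<Longrightarrow> initial_prod G n x \<in> carrier G"
  by (induction n) (auto simp: gtuples_in_carrier)

lemma contract_closed: "x \<in> gtuples G (Suc r) \<Longrightarrow> contract G r i x \<in> gtuples G r"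
  using continuous_map_image_subset_topspace [OF continuous_map_contract, of r i] by auto

text \<open>Writing \<open>j = Suc l\<close> removes the truncated subtraction. The two merges
  interact only if \<open>l = i\<close>: the entry at \<open>Suc k = i\<close> is then a product of
  three factors, bracketed differently on the two sides. In all other cases they affect different
  entries.\<close>

lemma contract_contract:
  assumes "i < j" "x \<in> gtuples G (Suc (Suc r))"
  shows "contract G r i (contract G (Suc r) j x) = contract G r (j - 1) (contract G (Suc r) i x)"
proof
  fix k
  show "contract G r i (contract G (Suc r) j x) k = contract G r (j - 1) (contract G (Suc r) i x) k"
  proof (cases "k < r")
    case True
    then have x: "x k \<in> carrier G" "x (Suc k) \<in> carrier G" "x (Suc (Suc k)) \<in> carrier G"
      using gtuples_in_carrier [OF assms(2)] by auto
    obtain l where l: "j = Suc l" "i \<le> l" using assms(1) by (cases j) auto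
    consider "Suc k < i" | "Suc k = i" "l = i" | "Suc k = i" "i < l"
      | "i < Suc k" "Suc k < l" | "i < Suc k" "Suc k = l" | "i < Suc k" "l < Suc k"
      using l(2) by linarith
    then show ?thesis
      by cases (use x l True in \<open>simp_all add: contract_def m_assoc\<close>)
  qed (simp add: contract_def)
qed

text \<open>Merging neighbours does not change a product, but once the merged entry lies among the
  first \<open>n\<close> entries, these use up \<open>n + 1\<close> entries of the original
  tuple.\<close>

lemma initial_prod_contract:
  assumes "x \<in> gtuples G (Suc r)" "n \<le> r" "0 < i"
  shows "initial_prod G n (contract G r i x)
    = (if n < i then initial_prod G n x else initial_prod G (Suc n) x)"
  using assms(2)
proof (induction n)
  case (Suc n)
  have "initial_prod G n x \<in> carrier G" "x n \<in> carrier G" "x (Suc n) \<in> carrier G"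
    using Suc.prems gtuples_in_carrier [OF assms(1)] initial_prod_closed [OF assms(1)] by auto
  with Suc assms(3) show ?case
    by (auto simp: contract_def m_assoc)
qed (use assms(3) in auto)

text \<open>Face 0 drops the first entry and lets it act from outside; the action thus restores the
  missing factor of the initial product.\<close>

lemma initial_prod_contract_0:
  assumes "x \<in> gtuples G (Suc r)" "n \<le> r"
  shows "x 0 \<otimes>\<^bsub>G\<^esub> initial_prod G n (contract G r 0 x) = initial_prod G (Suc n) x"
  using assms(2)
proof (induction n)
  case 0
  then show ?case using assms(1) by (simp add: gtuples_in_carrier)
next
  case (Suc n)
  have "contract G r 0 x n = x (Suc n)"
    using Suc.prems by (simp add: contract_0)
  moreover have "x 0 \<in> carrier G" "x (Suc n) \<in> carrier G"
    "initial_prod G n (contract G r 0 x) \<in> carrier G"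
    using Suc.prems gtuples_in_carrier [OF assms(1)]
      initial_prod_closed [OF contract_closed [OF assms(1)]] by auto
  ultimately show ?case
    using Suc by (simp add: m_assoc [symmetric])
qed

section \<open>The group of continuous cochains\<close>

lemma cochains_iff:
  "f \<in> carrier (cochains G T r A) \<longleftrightarrow> f \<in> extensional (gtuples G r) \<and>
    continuous_map (tuples_topology r) (discrete_topology (carrier A)) f"
  by (simp add: cochains_def)

lemma cochain_continuous:
  "f \<in> carrier (cochains G T r A) \<Longrightarrow>
    continuous_map (tuples_topology r) (discrete_topology (carrier A)) f"
  by (simp add: cochains_iff)

lemma cochain_closed:
  "f \<in> carrier (cochains G T r A) \<Longrightarrow> x \<in> gtuples G r \<Longrightarrow> f x \<in> carrier A"
  using continuous_map_image_subset_topspace [OF cochain_continuous, of f r A] by auto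

lemma cochain_eqI:
  assumes "f \<in> carrier (cochains G T r A)" "g \<in> carrier (cochains G T r A)"
    and "\<And>x. x \<in> gtuples G r \<Longrightarrow> f x = g x"
  shows "f = g"
  using assms by (auto simp: cochains_iff intro: extensionalityI)

lemma restrict_in_cochains:
  assumes "continuous_map (tuples_topology r) (discrete_topology (carrier A)) f"
  shows "restrict f (gtuples G r) \<in> carrier (cochains G T r A)"
  using continuous_map_eq [OF assms, of "restrict f (gtuples G r)"] by (simp add: cochains_iff)

lemma cochain_mult [simp]:
  "x \<in> gtuples G r \<Longrightarrow> (f \<otimes>\<^bsub>cochains G T r A\<^esub> g) x = f x \<otimes>\<^bsub>A\<^esub> g x"
  by (simp add: cochains_def)

lemma cochain_one [simp]: "x \<in> gtuples G r \<Longrightarrow> \<one>\<^bsub>cochains G T r A\<^esub> x = \<one>\<^bsub>A\<^esub>"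
  by (simp add: cochains_def)

lemma comm_group_cochains:
  assumes "comm_group A"
  shows "comm_group (cochains G T r A)"
proof -
  interpret A: comm_group A by fact
  have mult: "f \<otimes>\<^bsub>cochains G T r A\<^esub> g \<in> carrier (cochains G T r A)"
    if "f \<in> carrier (cochains G T r A)" "g \<in> carrier (cochains G T r A)" for f g
    using restrict_in_cochains [OF continuous_map_discrete_fun2
        [OF that [THEN cochain_continuous], of "monoid.mult A" "carrier A"]]
    by (simp add: cochains_def)
  have one: "\<one>\<^bsub>cochains G T r A\<^esub> \<in> carrier (cochains G T r A)"
    using restrict_in_cochains [of r A "\<lambda>_. \<one>\<^bsub>A\<^esub>"] by (simp add: cochains_def)
  show ?thesis
  proof (rule comm_groupI)
    fix f assume f: "f \<in> carrier (cochains G T r A)"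
    let ?g = "\<lambda>x\<in>gtuples G r. inv\<^bsub>A\<^esub> f x"
    have g: "?g \<in> carrier (cochains G T r A)"
      using restrict_in_cochains [OF continuous_map_discrete_fun
          [OF f [THEN cochain_continuous], of "m_inv A" "carrier A"]] by simp
    have "?g \<otimes>\<^bsub>cochains G T r A\<^esub> f = \<one>\<^bsub>cochains G T r A\<^esub>"
      by (rule cochain_eqI [OF mult [OF g f] one]) (use cochain_closed [OF f] in simp)
    with g show "\<exists>g\<in>carrier (cochains G T r A). g \<otimes>\<^bsub>cochains G T r A\<^esub> f = \<one>\<^bsub>cochains G T r A\<^esub>"
      by blast
  qed (auto intro!: mult one cochain_eqI [where r = r and A = A]
      simp: cochain_closed A.m_ac)
qed

text \<open>The record \<open>cochains\<close> prescribes only product and unit. Integer powers, and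
  so signs, are known pointwise because evaluation at a tuple is a homomorphism.\<close>

lemma cochain_eval_hom: "x \<in> gtuples G r \<Longrightarrow> (\<lambda>f. f x) \<in> hom (cochains G T r A) A"
  by (auto intro!: homI simp: cochain_closed)

lemma cochain_signed:
  "comm_group A \<Longrightarrow> f \<in> carrier (cochains G T r A) \<Longrightarrow> x \<in> gtuples G r \<Longrightarrow>
    signed (cochains G T r A) n f x = signed A n (f x)"
  by (rule hom_signed [OF cochain_eval_hom])
    (auto intro: comm_group_cochains comm_group.axioms(2))

section \<open>The coboundary as a homomorphism with square zero\<close>

lemma face_closed:
  assumes "discrete_gmodule G T A" "f \<in> carrier (cochains G T r A)" "x \<in> gtuples G (Suc r)"
  shows "face G r A i f x \<in> carrier A"
  using assms
  by (simp add: face_def act_closed cochain_closed contract_closed gtuples_in_carrier)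

lemma coboundary_eq_altprod:
  assumes "discrete_gmodule G T A" "f \<in> carrier (cochains G T r A)" "x \<in> gtuples G (Suc r)"
  shows "coboundary G r A f x = altprod A (Suc r) (\<lambda>i. face G r A i f x)"
proof -
  interpret A: comm_group A using assms(1) by (rule discrete_gmodule_comm_group)
  note cl = face_closed [OF assms]
  have 0: "signed A 0 (face G r A 0 f x) = act A (x 0) (f (\<lambda>k\<in>{..<r}. x (Suc k)))"
    using cl [of 0] by (simp add: face_def contract_0)
  have "altprod A r (\<lambda>i. face G r A i f x) = signed A 0 (face G r A 0 f x) \<otimes>\<^bsub>A\<^esub>
      (\<Otimes>\<^bsub>A\<^esub>i\<in>{Suc 0..r}. signed A i (face G r A i f x))"
    unfolding altprod_def by (subst A.finprod_0') (auto intro!: cl)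
  also have "(\<Otimes>\<^bsub>A\<^esub>i\<in>{Suc 0..r}. signed A i (face G r A i f x))
      = (\<Otimes>\<^bsub>A\<^esub>i\<in>{1..r}. f (contract G r i x) [^]\<^bsub>A\<^esub> ((-1) ^ i :: int))"
    using cochain_closed [OF assms(2) contract_closed [OF assms(3)]]
    by (intro A.finprod_cong') (auto simp: face_def signed_def)
  finally show ?thesis
    using assms(3) cl
    by (simp add: A.altprod_Suc 0 coboundary_def)
      (simp add: face_def contract_Suc signed_def)
qed

lemma continuous_map_face:
  assumes "discrete_gmodule G T A" "f \<in> carrier (cochains G T r A)"
  shows "continuous_map (tuples_topology (Suc r)) (discrete_topology (carrier A)) (face G r A i f)"
proof -
  have f: "continuous_map (tuples_topology (Suc r)) (discrete_topology (carrier A))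
      (\<lambda>x. f (contract G r i x))"
    using continuous_map_compose [OF continuous_map_contract cochain_continuous [OF assms(2)]]
    by (simp add: o_def)
  show ?thesis
    unfolding face_def [abs_def]
    using f continuous_map_act [OF assms(1) continuous_map_coord [of 0] f] by auto
qed

lemma continuous_map_altprod:
  assumes "comm_group A"
    and "\<And>i. i \<le> n \<Longrightarrow> continuous_map X (discrete_topology (carrier A)) (a i)"
  shows "continuous_map X (discrete_topology (carrier A)) (\<lambda>x. altprod A n (\<lambda>i. a i x))"
proof -
  interpret A: comm_group A by fact
  have cl: "a i x \<in> carrier A" if "i \<le> n" "x \<in> topspace X" for i x
    using continuous_map_image_subset_topspace [OF assms(2) [OF that(1)]] that by auto
  show ?thesis
    using assms(2) cl
  proof (induction n)
    case 0
    then have "continuous_map X (discrete_topology (carrier A)) (a 0)" by simp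
    then show ?case
      by (rule continuous_map_eq) (simp add: 0 A.altprod_0)
  next
    case (Suc n)
    have "continuous_map X (discrete_topology (carrier A))
        (\<lambda>x. altprod A n (\<lambda>i. a i x) \<otimes>\<^bsub>A\<^esub> signed A (Suc n) (a (Suc n) x))"
      by (rule continuous_map_discrete_fun2 [where U = "carrier A" and V = "carrier A"])
        (use Suc in auto)
    then show ?case
      by (rule continuous_map_eq) (use Suc in \<open>simp add: A.altprod_Suc\<close>)
  qed
qed

lemma coboundary_closed:
  assumes "discrete_gmodule G T A" "f \<in> carrier (cochains G T r A)"
  shows "coboundary G r A f \<in> carrier (cochains G T (Suc r) A)"
proof -
  have "coboundary G r A f
      = (\<lambda>x\<in>gtuples G (Suc r). altprod A (Suc r) (\<lambda>i. face G r A i f x))"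
    using coboundary_eq_altprod [OF assms]
    by (intro extensionalityI [of _ "gtuples G (Suc r)"]) (auto simp: coboundary_def)
  then show ?thesis
    using assms by (auto intro!: restrict_in_cochains continuous_map_altprod continuous_map_face
        discrete_gmodule_comm_group)
qed

lemma coboundary_hom:
  assumes "discrete_gmodule G T A"
  shows "coboundary G r A \<in> hom (cochains G T r A) (cochains G T (Suc r) A)"
proof (rule homI)
  interpret A: comm_group A using assms by (rule discrete_gmodule_comm_group)
  interpret C: comm_group "cochains G T r A" by (rule comm_group_cochains) unfold_locales
  interpret D: comm_group "cochains G T (Suc r) A" by (rule comm_group_cochains) unfold_locales
  show "coboundary G r A f \<in> carrier (cochains G T (Suc r) A)"
    if "f \<in> carrier (cochains G T r A)" for f
    using coboundary_closed [OF assms that] .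
  fix f g assume f: "f \<in> carrier (cochains G T r A)" and g: "g \<in> carrier (cochains G T r A)"
  show "coboundary G r A (f \<otimes>\<^bsub>cochains G T r A\<^esub> g)
      = coboundary G r A f \<otimes>\<^bsub>cochains G T (Suc r) A\<^esub> coboundary G r A g"
  proof (rule cochain_eqI)
    fix x assume x: "x \<in> gtuples G (Suc r)"
    have "face G r A i (f \<otimes>\<^bsub>cochains G T r A\<^esub> g) x = face G r A i f x \<otimes>\<^bsub>A\<^esub> face G r A i g x" for i
      using x f g contract_closed [OF x]
      by (simp add: face_def cochain_closed gtuples_in_carrier
          hom_mult [OF act_hom [OF assms]])
    then show "coboundary G r A (f \<otimes>\<^bsub>cochains G T r A\<^esub> g) x
        = (coboundary G r A f \<otimes>\<^bsub>cochains G T (Suc r) A\<^esub> coboundary G r A g) x"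
      using x f g by (simp add: coboundary_eq_altprod [OF assms] A.altprod_mult face_closed [OF assms])
  qed (use f g coboundary_closed [OF assms] in auto)
qed

lemma coboundary_coboundary:
  assumes "discrete_gmodule G T A" "f \<in> carrier (cochains G T r A)"
  shows "coboundary G (Suc r) A (coboundary G r A f) = \<one>\<^bsub>cochains G T (Suc (Suc r)) A\<^esub>"
proof (rule cochain_eqI)
  interpret A: comm_group A using assms(1) by (rule discrete_gmodule_comm_group)
  interpret C: comm_group "cochains G T (Suc (Suc r)) A"
    by (rule comm_group_cochains) unfold_locales
  note d = coboundary_closed [OF assms]
  show "coboundary G (Suc r) A (coboundary G r A f) \<in> carrier (cochains G T (Suc (Suc r)) A)"
    by (rule coboundary_closed [OF assms(1) d])
  show "\<one>\<^bsub>cochains G T (Suc (Suc r)) A\<^esub> \<in> carrier (cochains G T (Suc (Suc r)) A)" by simp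
  fix x assume x: "x \<in> gtuples G (Suc (Suc r))"
  \<comment> \<open>The inner face \<open>i\<close> is taken at the tuple already contracted by the
    outer face \<open>j\<close>; the first entry of \<open>x\<close> acts in addition if
    \<open>j = 0\<close>.\<close>
  define a where "a j i = (if j = 0 then act A (x 0) (face G r A i f (contract G (Suc r) j x))
      else face G r A i f (contract G (Suc r) j x))" for j i
  have x0: "x 0 \<in> carrier G" "x 1 \<in> carrier G" using gtuples_in_carrier [OF x] by auto
  note cx = contract_closed [OF x]
  have a_closed: "a j i \<in> carrier A" for i j
    using x0 by (auto simp: a_def intro!: act_closed [OF assms(1)] face_closed [OF assms] cx)
  have "face G (Suc r) A j (coboundary G r A f) x = altprod A (Suc r) (a j)" for j
  proof (cases "j = 0")
    case True
    then show ?thesis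
      unfolding face_def [of G "Suc r"] a_def
      by (simp add: coboundary_eq_altprod [OF assms cx] hom_altprod [OF act_hom [OF assms(1) x0(1)]
          A.comm_group_axioms A.comm_group_axioms face_closed [OF assms cx]])
  next
    case False
    then show ?thesis
      unfolding face_def [of G "Suc r"] a_def by (simp add: coboundary_eq_altprod [OF assms cx])
  qed
  then have "coboundary G (Suc r) A (coboundary G r A f) x
      = altprod A (Suc (Suc r)) (\<lambda>j. altprod A (Suc r) (a j))"
    by (simp add: coboundary_eq_altprod [OF assms(1) d x])
  also have "\<dots> = \<one>\<^bsub>A\<^esub>"
  proof (rule A.altprod_cosimplicial)
    fix i j :: nat assume ij: "i < j"
    note cc = contract_contract [OF ij x]
    have f: "f (contract G r k (contract G (Suc r) l x)) \<in> carrier A" for k l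
      by (intro cochain_closed [OF assms(2)] contract_closed x)
    \<comment> \<open>The action interferes with the contractions only in the first case: merging
      the first two entries corresponds to letting them act one after the other. For
      \<open>j > 1\<close> the first entry survives the outer contraction unchanged.\<close>
    consider "i = 0" "j = 1" | "i = 0" "j > 1" | "i > 0" "j > 1" using ij by linarith
    then show "a j i = a i (j - 1)"
    proof cases
      case 1
      have "contract G (Suc r) 1 x 0 = x 0 \<otimes>\<^bsub>G\<^esub> x 1" "contract G (Suc r) 0 x 0 = x 1"
        by (simp_all add: contract_def)
      then show ?thesis
        using 1 cc f x0 by (simp add: a_def face_def act_mult [OF assms(1)])
    next
      case 2
      then have "contract G (Suc r) j x 0 = x 0" by (simp add: contract_def)
      then show ?thesis using 2 cc by (simp add: a_def face_def)
    next
      case 3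
      then show ?thesis using cc by (simp add: a_def face_def)
    qed
  qed (rule a_closed)
  finally show "coboundary G (Suc r) A (coboundary G r A f) x = \<one>\<^bsub>cochains G T (Suc (Suc r)) A\<^esub> x"
    using x by simp
qed

end

lemma G_bilinear_hom_left: "G_bilinear G A B C p \<Longrightarrow> b \<in> carrier B \<Longrightarrow> (\<lambda>a. p a b) \<in> hom A C"
  by (simp add: G_bilinear_def)

lemma G_bilinear_hom_right: "G_bilinear G A B C p \<Longrightarrow> a \<in> carrier A \<Longrightarrow> p a \<in> hom B C"
  unfolding G_bilinear_def by (simp add: eta_contract_eq)

lemma G_bilinear_closed:
  "G_bilinear G A B C p \<Longrightarrow> a \<in> carrier A \<Longrightarrow> b \<in> carrier B \<Longrightarrow> p a b \<in> carrier C"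
  by (meson G_bilinear_hom_right hom_in_carrier)

lemma G_bilinear_act:
  "G_bilinear G A B C p \<Longrightarrow> g \<in> carrier G \<Longrightarrow> a \<in> carrier A \<Longrightarrow> b \<in> carrier B \<Longrightarrow>
    act C g (p a b) = p (act A g a) (act B g b)"
  by (simp add: G_bilinear_def)

context topological_group_structure
begin

section \<open>Cocycles, coboundaries and classes\<close>

lemma group_cochains: "discrete_gmodule G T A \<Longrightarrow> group (cochains G T r A)"
  by (simp add: comm_group.axioms(2) comm_group_cochains discrete_gmodule_comm_group)

lemma cochain_one_closed:
  "discrete_gmodule G T A \<Longrightarrow> \<one>\<^bsub>cochains G T r A\<^esub> \<in> carrier (cochains G T r A)"
  by (simp add: group_cochains group.is_monoid monoid.one_closed)

lemma group_hom_coboundary: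
  "discrete_gmodule G T A \<Longrightarrow>
    group_hom (cochains G T r A) (cochains G T (Suc r) A) (coboundary G r A)"
  by (simp add: group_hom_def group_hom_axioms_def group_cochains coboundary_hom)

lemma cocycles_iff:
  "f \<in> cocycles G T r A \<longleftrightarrow>
    f \<in> carrier (cochains G T r A) \<and> coboundary G r A f = \<one>\<^bsub>cochains G T (Suc r) A\<^esub>"
  by (simp add: cocycles_def kernel_def)

lemma cocycle_cochain: "f \<in> cocycles G T r A \<Longrightarrow> f \<in> carrier (cochains G T r A)"
  by (simp add: cocycles_iff)

lemma subgroup_cocycles:
  "discrete_gmodule G T A \<Longrightarrow> subgroup (cocycles G T r A) (cochains G T r A)"
  unfolding cocycles_def by (rule group_hom.subgroup_kernel [OF group_hom_coboundary])

lemma subgroup_coboundaries: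
  assumes "discrete_gmodule G T A"
  shows "subgroup (coboundaries G T r A) (cochains G T r A)"
proof (cases r)
  case 0
  then show ?thesis
    using group.triv_subgroup [OF group_cochains [OF assms]] by (simp add: coboundaries_def)
next
  case (Suc n)
  then show ?thesis
    using group_hom.img_is_subgroup [OF group_hom_coboundary [OF assms]]
    by (simp add: coboundaries_def)
qed

lemma coboundary_in_coboundaries:
  "f \<in> carrier (cochains G T r A) \<Longrightarrow> coboundary G r A f \<in> coboundaries G T (Suc r) A"
  by (simp add: coboundaries_def)

lemma coboundaries_subset_cocycles:
  assumes "discrete_gmodule G T A"
  shows "coboundaries G T r A \<subseteq> cocycles G T r A"
proof (cases r)
  case 0
  then show ?thesis
    using subgroup.one_closed [OF subgroup_cocycles [OF assms]] by (simp add: coboundaries_def)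
next
  case (Suc n)
  then show ?thesis
    by (auto simp: coboundaries_def cocycles_iff coboundary_closed [OF assms]
        coboundary_coboundary [OF assms])
qed

lemma coboundaries_cochain:
  "discrete_gmodule G T A \<Longrightarrow> f \<in> coboundaries G T r A \<Longrightarrow> f \<in> carrier (cochains G T r A)"
  using coboundaries_subset_cocycles cocycle_cochain by blast

lemma coclass_eqI:
  assumes "discrete_gmodule G T A" "b \<in> coboundaries G T r A" "f \<in> carrier (cochains G T r A)"
  shows "coclass G T r A (b \<otimes>\<^bsub>cochains G T r A\<^esub> f) = coclass G T r A f"
proof -
  interpret C: group "cochains G T r A" by (rule group_cochains) fact
  note sub = subgroup_coboundaries [OF assms(1), of r]
  have "b \<otimes>\<^bsub>cochains G T r A\<^esub> f \<in> coboundaries G T r A #>\<^bsub>cochains G T r A\<^esub> f"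
    using assms(2) by (auto simp: r_coset_def)
  from C.repr_independence [OF this assms(3) sub] show ?thesis
    by (simp add: coclass_def)
qed

lemma coclass_eqE:
  assumes "discrete_gmodule G T A" "f \<in> carrier (cochains G T r A)"
    and "h \<in> carrier (cochains G T r A)" "coclass G T r A h = coclass G T r A f"
  obtains b where "b \<in> coboundaries G T r A" "h = b \<otimes>\<^bsub>cochains G T r A\<^esub> f"
proof -
  interpret C: group "cochains G T r A" by (rule group_cochains) fact
  have "h \<in> coboundaries G T r A #>\<^bsub>cochains G T r A\<^esub> f"
    using C.rcos_self [OF assms(3) subgroup_coboundaries [OF assms(1)]] assms(4)
    by (simp add: coclass_def)
  then show ?thesis using that by (auto simp: r_coset_def)
qed

lemma cohomologyE:
  assumes "\<alpha> \<in> carrier (cohomology G T r A)"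
  obtains f where "f \<in> cocycles G T r A" "\<alpha> = coclass G T r A f"
  using assms by (auto simp: cohomology_def FactGroup_def RCOSETS_def r_coset_def coclass_def)

text \<open>Inside \<open>aug_cup\<close> the sign is an exponent on cochains, while in the first
  formula it is an exponent in the quotient group; this reconciles the two. Coboundaries are normal
  in the cocycles because the cochain group is abelian, and powers in the subgroup of cocycles agree
  with powers of cochains.\<close>

lemma coclass_int_pow:
  assumes "discrete_gmodule G T A" "f \<in> cocycles G T r A"
  shows "coclass G T r A f [^]\<^bsub>cohomology G T r A\<^esub> (k::int)
    = coclass G T r A (f [^]\<^bsub>cochains G T r A\<^esub> k)"
proof -
  let ?C = "cochains G T r A" and ?Z = "cocycles G T r A"
  interpret C: comm_group ?C
    by (intro comm_group_cochains discrete_gmodule_comm_group) fact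
  note Z = subgroup_cocycles [OF assms(1), of r]
  have "normal (coboundaries G T r A) (?C\<lparr>carrier := ?Z\<rparr>)"
    by (intro C.normal_restrict_supergroup Z C.subgroup_imp_normal subgroup_coboundaries
        coboundaries_subset_cocycles assms(1))
  from normal.FactGroup_int_pow [OF this, of f k] show ?thesis
    using assms(2) C.int_pow_consistent [OF Z assms(2)]
    by (simp add: cohomology_def coclass_def r_coset_def)
qed

section \<open>Functoriality in the coefficients\<close>

lemma gmodule_hom_hom: "h \<in> gmodule_hom G A B \<Longrightarrow> h \<in> hom A B"
  by (simp add: gmodule_hom_def)

lemma push_apply [simp]: "x \<in> gtuples G r \<Longrightarrow> push G r h f x = h (f x)"
  by (simp add: push_def compose_eq)

lemma push_closed:
  assumes "h \<in> hom A B" "f \<in> carrier (cochains G T r A)"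
  shows "push G r h f \<in> carrier (cochains G T r B)"
  unfolding push_def compose_def
  by (intro restrict_in_cochains continuous_map_discrete_fun [OF cochain_continuous [OF assms(2)]]
      hom_in_carrier [OF assms(1)])

lemma push_hom:
  assumes "discrete_gmodule G T A" "discrete_gmodule G T B" "h \<in> hom A B"
  shows "push G r h \<in> hom (cochains G T r A) (cochains G T r B)"
proof (rule homI)
  interpret C: group "cochains G T r A" by (rule group_cochains) fact
  interpret D: group "cochains G T r B" by (rule group_cochains) fact
  note cl = push_closed [OF assms(3)]
  show "push G r h f \<in> carrier (cochains G T r B)" if "f \<in> carrier (cochains G T r A)" for f
    using cl that .
  fix f g assume "f \<in> carrier (cochains G T r A)" "g \<in> carrier (cochains G T r A)"
  then show "push G r h (f \<otimes>\<^bsub>cochains G T r A\<^esub> g)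
      = push G r h f \<otimes>\<^bsub>cochains G T r B\<^esub> push G r h g"
    by (intro cochain_eqI [where r = r and A = B] cl D.m_closed C.m_closed)
      (auto simp: cochain_closed hom_mult [OF assms(3)])
qed

lemma push_one:
  "discrete_gmodule G T A \<Longrightarrow> discrete_gmodule G T B \<Longrightarrow> h \<in> hom A B \<Longrightarrow>
    push G r h \<one>\<^bsub>cochains G T r A\<^esub> = \<one>\<^bsub>cochains G T r B\<^esub>"
  by (intro hom_one [where h = "push G r h"] push_hom group_cochains)

lemma push_coboundary:
  assumes "discrete_gmodule G T A" "discrete_gmodule G T B" "h \<in> gmodule_hom G A B"
    and "f \<in> carrier (cochains G T r A)"
  shows "push G (Suc r) h (coboundary G r A f) = coboundary G r B (push G r h f)"
proof (rule cochain_eqI)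
  have hom: "h \<in> hom A B"
    and act: "\<And>g a. g \<in> carrier G \<Longrightarrow> a \<in> carrier A \<Longrightarrow> h (act A g a) = act B g (h a)"
    using assms(3) by (auto simp: gmodule_hom_def)
  note cl = push_closed [OF hom]
  show "push G (Suc r) h (coboundary G r A f) \<in> carrier (cochains G T (Suc r) B)"
    by (intro cl coboundary_closed [OF assms(1)] assms(4))
  show "coboundary G r B (push G r h f) \<in> carrier (cochains G T (Suc r) B)"
    by (intro cl coboundary_closed [OF assms(2)] assms(4))
  fix x assume x: "x \<in> gtuples G (Suc r)"
  have "h (face G r A i f x) = face G r B i (push G r h f) x" for i
    using contract_closed [OF x] gtuples_in_carrier [OF x] cochain_closed [OF assms(4)]
    by (simp add: face_def act)
  then show "push G (Suc r) h (coboundary G r A f) x = coboundary G r B (push G r h f) x"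
    using x face_closed [OF assms(1,4) x] cl [OF assms(4)] assms(1,2)
    by (simp add: coboundary_eq_altprod assms(4) hom_altprod [OF hom]
        discrete_gmodule_comm_group)
qed

lemma push_cocycle:
  assumes "discrete_gmodule G T A" "discrete_gmodule G T B" "h \<in> gmodule_hom G A B"
    and "f \<in> cocycles G T r A"
  shows "push G r h f \<in> cocycles G T r B"
proof -
  have hom: "h \<in> hom A B" using assms(3) by (simp add: gmodule_hom_def)
  have "push G (Suc r) h \<one>\<^bsub>cochains G T (Suc r) A\<^esub> = \<one>\<^bsub>cochains G T (Suc r) B\<^esub>"
    by (intro push_one assms hom)
  then show ?thesis
    using assms push_coboundary [OF assms(1-3), of f r] push_closed [OF hom]
    by (simp add: cocycles_iff)
qed

lemma push_coboundaries:
  assumes "discrete_gmodule G T A" "discrete_gmodule G T B" "h \<in> gmodule_hom G A B"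
    and "f \<in> coboundaries G T r A"
  shows "push G r h f \<in> coboundaries G T r B"
proof (cases r)
  case 0
  have "h \<in> hom A B" using assms(3) by (simp add: gmodule_hom_def)
  then have "push G r h \<one>\<^bsub>cochains G T r A\<^esub> = \<one>\<^bsub>cochains G T r B\<^esub>"
    by (intro push_one assms)
  then show ?thesis using assms(4) 0 by (simp add: coboundaries_def)
next
  case (Suc n)
  then show ?thesis
    using assms(4) push_coboundary [OF assms(1-3)]
      push_closed [OF gmodule_hom_hom [OF assms(3)]]
    by (auto simp: coboundaries_def)
qed

text \<open>Two representatives differ by a coboundary, which \<open>push\<close> sends to a
  coboundary; so the description has exactly one candidate.\<close>

lemma cohomology_map_coclass:
  assumes "discrete_gmodule G T A" "discrete_gmodule G T B" "h \<in> gmodule_hom G A B"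
    and "f \<in> cocycles G T r A"
  shows "cohomology_map G T r A B h (coclass G T r A f) = coclass G T r B (push G r h f)"
  unfolding cohomology_map_def
proof (rule the_equality)
  show "\<exists>f'. represents G T r A f' (coclass G T r A f) \<and>
      coclass G T r B (push G r h f) = coclass G T r B (push G r h f')"
    using assms(4) by (auto simp: represents_def)
  fix \<gamma>
  assume "\<exists>f'. represents G T r A f' (coclass G T r A f) \<and> \<gamma> = coclass G T r B (push G r h f')"
  then obtain f' where f': "f' \<in> cocycles G T r A" "coclass G T r A f' = coclass G T r A f"
    and \<gamma>: "\<gamma> = coclass G T r B (push G r h f')"
    by (auto simp: represents_def)
  obtain b where b: "b \<in> coboundaries G T r A" "f' = b \<otimes>\<^bsub>cochains G T r A\<^esub> f"
    using coclass_eqE [OF assms(1) _ _ f'(2)] f'(1) assms(4) cocycle_cochain by metis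
  have hom: "h \<in> hom A B" using assms(3) by (simp add: gmodule_hom_def)
  have "push G r h f' = push G r h b \<otimes>\<^bsub>cochains G T r B\<^esub> push G r h f"
    unfolding b(2) using b(1) assms
    by (intro hom_mult [OF push_hom [OF assms(1,2) hom]]) (auto simp: cocycle_cochain coboundaries_cochain)
  then show "\<gamma> = coclass G T r B (push G r h f)"
    unfolding \<gamma> using push_coboundaries [OF assms(1-3) b(1)] push_cocycle [OF assms]
    by (simp add: coclass_eqI assms(2) cocycle_cochain)
qed

section \<open>Cup products\<close>

lemma cup_apply:
  "x \<in> gtuples G (r + s) \<Longrightarrow> cup G r s B p f g x =
    p (f (restrict x {..<r})) (act B (initial_prod G r x) (g (\<lambda>k\<in>{..<s}. x (r + k))))"
  by (simp add: cup_def)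

lemma restrict_closed:
  "x \<in> gtuples G (r + s) \<Longrightarrow> f \<in> carrier (cochains G T r A) \<Longrightarrow> f (restrict x {..<r}) \<in> carrier A"
  by (auto intro!: cochain_closed restrict_in_gtuples)

lemma act_shift_closed:
  "discrete_gmodule G T B \<Longrightarrow> x \<in> gtuples G (r + s) \<Longrightarrow> g \<in> carrier (cochains G T s B) \<Longrightarrow>
    act B (initial_prod G r x) (g (\<lambda>k\<in>{..<s}. x (r + k))) \<in> carrier B"
  by (erule act_closed [OF _ initial_prod_closed]) (auto simp del: restrict_apply
      intro!: cochain_closed [of g] shift_in_gtuples)

lemma cup_closed:
  assumes "discrete_gmodule G T B" "G_bilinear G A B C p"
    and f: "f \<in> carrier (cochains G T r A)" and g: "g \<in> carrier (cochains G T s B)"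
  shows "cup G r s B p f g \<in> carrier (cochains G T (r + s) C)"
proof -
  let ?X = "tuples_topology (r + s)"
  have "continuous_map ?X (tuples_topology r) (\<lambda>x. restrict x {..<r})"
    by (rule continuous_map_into_tuples) (rule continuous_map_coord, simp)
  from continuous_map_compose [OF this cochain_continuous [OF f]]
  have F: "continuous_map ?X (discrete_topology (carrier A)) (\<lambda>x. f (restrict x {..<r}))"
    by (simp add: o_def)
  have "continuous_map ?X (tuples_topology s) (\<lambda>x. \<lambda>k\<in>{..<s}. x (r + k))"
    by (rule continuous_map_into_tuples) (rule continuous_map_coord, simp)
  from continuous_map_compose [OF this cochain_continuous [OF g]]
  have "continuous_map ?X (discrete_topology (carrier B)) (\<lambda>x. g (\<lambda>k\<in>{..<s}. x (r + k)))"
    by (simp add: o_def)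
  then have "continuous_map ?X (discrete_topology (carrier B))
      (\<lambda>x. act B (initial_prod G r x) (g (\<lambda>k\<in>{..<s}. x (r + k))))"
    by (intro continuous_map_act assms continuous_map_initial_prod) auto
  from continuous_map_discrete_fun2 [OF F this, of p "carrier C"] show ?thesis
    unfolding cup_def by (intro restrict_in_cochains) (auto simp: G_bilinear_closed [OF assms(2)])
qed

lemma cup_hom_left:
  assumes "discrete_gmodule G T A" "discrete_gmodule G T B" "discrete_gmodule G T C"
    and "G_bilinear G A B C p" and g: "g \<in> carrier (cochains G T s B)"
  shows "(\<lambda>f. cup G r s B p f g) \<in> hom (cochains G T r A) (cochains G T (r + s) C)"
proof (rule homI)
  interpret A: group "cochains G T r A" by (rule group_cochains) fact
  interpret C: group "cochains G T (r + s) C" by (rule group_cochains) fact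
  note cl = cup_closed [OF assms(2,4) _ g]
  show "cup G r s B p f g \<in> carrier (cochains G T (r + s) C)"
    if "f \<in> carrier (cochains G T r A)" for f using cl that .
  fix f f' assume f: "f \<in> carrier (cochains G T r A)" "f' \<in> carrier (cochains G T r A)"
  show "cup G r s B p (f \<otimes>\<^bsub>cochains G T r A\<^esub> f') g
      = cup G r s B p f g \<otimes>\<^bsub>cochains G T (r + s) C\<^esub> cup G r s B p f' g"
  proof (rule cochain_eqI)
    fix x assume x: "x \<in> gtuples G (r + s)"
    then have "restrict x {..<r} \<in> gtuples G r" by (auto intro!: restrict_in_gtuples)
    then show "cup G r s B p (f \<otimes>\<^bsub>cochains G T r A\<^esub> f') g x
        = (cup G r s B p f g \<otimes>\<^bsub>cochains G T (r + s) C\<^esub> cup G r s B p f' g) x"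
      using x f by (simp add: cup_apply restrict_closed
          hom_mult [OF G_bilinear_hom_left [OF assms(4) act_shift_closed [OF assms(2) x g]]])
  qed (use f cl in auto)
qed

lemma cup_hom_right:
  assumes "discrete_gmodule G T B" "discrete_gmodule G T C"
    and "G_bilinear G A B C p" and f: "f \<in> carrier (cochains G T r A)"
  shows "cup G r s B p f \<in> hom (cochains G T s B) (cochains G T (r + s) C)"
proof (rule homI)
  interpret B: group "cochains G T s B" by (rule group_cochains) fact
  interpret C: group "cochains G T (r + s) C" by (rule group_cochains) fact
  note cl = cup_closed [OF assms(1,3) f]
  show "cup G r s B p f g \<in> carrier (cochains G T (r + s) C)"
    if "g \<in> carrier (cochains G T s B)" for g using cl that .
  fix g g' assume g: "g \<in> carrier (cochains G T s B)" "g' \<in> carrier (cochains G T s B)"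
  show "cup G r s B p f (g \<otimes>\<^bsub>cochains G T s B\<^esub> g')
      = cup G r s B p f g \<otimes>\<^bsub>cochains G T (r + s) C\<^esub> cup G r s B p f g'"
  proof (rule cochain_eqI)
    fix x assume x: "x \<in> gtuples G (r + s)"
    note x' = shift_in_gtuples [OF x]
    have "initial_prod G r x \<in> carrier G" using x by simp
    note h = hom_mult [OF act_hom [OF assms(1) this]]
      hom_mult [OF G_bilinear_hom_right [OF assms(3) restrict_closed [OF x f]]]
    show "cup G r s B p f (g \<otimes>\<^bsub>cochains G T s B\<^esub> g') x
        = (cup G r s B p f g \<otimes>\<^bsub>cochains G T (r + s) C\<^esub> cup G r s B p f g') x"
      using x x' g by (simp add: cup_apply act_shift_closed [OF assms(1)] cochain_closed h)
  qed (use g cl in auto)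
qed

text \<open>At a fixed tuple one factor of the pairing is constant in each summand on the right, so
  additivity in the other factor pulls the alternating product of faces out. What remains is to
  match the faces as \<open>altprod_concat\<close> requires.\<close>

lemma coboundary_cup:
  assumes A: "discrete_gmodule G T A" and B: "discrete_gmodule G T B"
    and C: "discrete_gmodule G T C" and p: "G_bilinear G A B C p"
    and f: "f \<in> carrier (cochains G T r A)" and g: "g \<in> carrier (cochains G T s B)"
  shows "coboundary G (r + s) C (cup G r s B p f g)
    = cup G (Suc r) s B p (coboundary G r A f) g
      \<otimes>\<^bsub>cochains G T (Suc (r + s)) C\<^esub>
      signed (cochains G T (Suc (r + s)) C) r (cup G r (Suc s) B p f (coboundary G s B g))"
    (is "?lhs = ?df \<otimes>\<^bsub>?C\<^esub> signed ?C r ?dg")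
proof (rule cochain_eqI)
  interpret A: comm_group A using A by (rule discrete_gmodule_comm_group)
  interpret B: comm_group B using B by (rule discrete_gmodule_comm_group)
  interpret C: comm_group C using C by (rule discrete_gmodule_comm_group)
  interpret CC: comm_group ?C by (rule comm_group_cochains) unfold_locales
  note fg = cup_closed [OF B p f g]
  have df: "?df \<in> carrier ?C"
    using cup_closed [OF B p coboundary_closed [OF A f] g] by simp
  have dg: "?dg \<in> carrier ?C"
    using cup_closed [OF B p f coboundary_closed [OF B g]] by simp
  show "?lhs \<in> carrier ?C" by (rule coboundary_closed [OF C fg])
  show "?df \<otimes>\<^bsub>?C\<^esub> signed ?C r ?dg \<in> carrier ?C" using df dg by simp
  fix x assume x: "x \<in> gtuples G (Suc (r + s))"
  then have xl: "x \<in> gtuples G (Suc r + s)" and xr: "x \<in> gtuples G (r + Suc s)" by simp_all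
  let ?u = "restrict x {..<Suc r}" and ?w = "\<lambda>k\<in>{..<Suc s}. x (r + k)"
  let ?b = "act B (initial_prod G (Suc r) x) (g (\<lambda>k\<in>{..<s}. x (Suc r + k)))"
  let ?a = "f (restrict x {..<r})"
  \<comment> \<open>The tuple has r + s + 1 entries. Its first r + 1 form \<open>?u\<close> and its
    last s + 1 form \<open>?w\<close>, overlapping in the entry \<open>x r\<close>. \<open>P\<close>
    lists the faces of \<open>f\<close> on \<open>?u\<close>, \<open>Q\<close> those of
    \<open>g\<close> on \<open>?w\<close>, and \<open>R\<close> those of the cup product.\<close>
  define P where "P i = p (face G r A i f ?u) ?b" for i
  define Q where "Q i = p ?a (act B (initial_prod G r x) (face G s B i g ?w))" for i
  define R where "R i = face G (r + s) C i (cup G r s B p f g) x" for i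
  have u: "?u \<in> gtuples G (Suc r)" using x by (rule restrict_in_gtuples) simp
  have w: "?w \<in> gtuples G (Suc s)" using xr by (rule shift_in_gtuples)
  have a: "?a \<in> carrier A" using xr f by (rule restrict_closed)
  have b: "?b \<in> carrier B" using B xl g by (rule act_shift_closed)
  have xk: "x k \<in> carrier G" if "k \<le> r + s" for k using gtuples_in_carrier [OF x] that by simp
  have ir: "initial_prod G k x \<in> carrier G" if "k \<le> Suc (r + s)" for k
    using x that by (rule initial_prod_closed)
  have gk: "g y \<in> carrier B" if "y \<in> gtuples G s" for y using g that by (rule cochain_closed)
  have P: "P i \<in> carrier C" for i
    unfolding P_def by (intro G_bilinear_closed [OF p] face_closed [OF A f u] b)
  have Q: "Q i \<in> carrier C" for i
    unfolding Q_def by (intro G_bilinear_closed [OF p] a act_closed [OF B] face_closed [OF B g w] ir) simp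
  have "?df x = altprod C (Suc r) P"
    unfolding P_def cup_apply [OF xl] coboundary_eq_altprod [OF A f u]
    by (rule hom_altprod [OF G_bilinear_hom_left [OF p b]])
      (auto intro: A.comm_group_axioms C.comm_group_axioms face_closed [OF A f u])
  moreover have "?dg x = altprod C (Suc s) Q"
  proof -
    have "act B (initial_prod G r x) (coboundary G s B g ?w)
        = altprod B (Suc s) (\<lambda>i. act B (initial_prod G r x) (face G s B i g ?w))"
      unfolding coboundary_eq_altprod [OF B g w]
      by (rule hom_altprod [OF act_hom [OF B ir]])
        (auto intro: B.comm_group_axioms face_closed [OF B g w])
    then show ?thesis
      unfolding Q_def cup_apply [OF xr]
      by (simp only:) (rule hom_altprod [OF G_bilinear_hom_right [OF p a]],
        auto intro!: B.comm_group_axioms C.comm_group_axioms face_closed [OF B g w] act_closed [OF B] ir)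
  qed
  moreover have "?lhs x = altprod C (r + Suc s) R"
    unfolding R_def by (simp add: coboundary_eq_altprod [OF C fg x])
  moreover have "altprod C (r + Suc s) R
      = altprod C (Suc r) P \<otimes>\<^bsub>C\<^esub> signed C r (altprod C (Suc s) Q)"
  proof (rule C.altprod_concat)
    have c: "contract G (r + s) i x \<in> gtuples G (r + s)" for i using contract_closed [OF x] .
    show "R i = P i" if "i \<le> r" for i
    proof -
      have 1: "restrict (contract G (r + s) i x) {..<r} = contract G r i ?u"
        using that by (auto simp: contract_def fun_eq_iff)
      have 2: "(\<lambda>k\<in>{..<s}. contract G (r + s) i x (r + k)) = (\<lambda>k\<in>{..<s}. x (Suc r + k))"
        using that by (auto simp: contract_def fun_eq_iff)
      have f1: "f (contract G r i ?u) \<in> carrier A"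
        by (intro cochain_closed [OF f] contract_closed u)
      have g1: "g (\<lambda>k\<in>{..<s}. x (Suc r + k)) \<in> carrier B"
        by (intro gk shift_in_gtuples xl)
      \<comment> \<open>For \<open>i = 0\<close> the first entry acts on a value of the pairing, and
        equivariance distributes it: on the left it gives face 0 of \<open>f\<close>, on the right
        it completes the initial product to r + 1 factors. For \<open>i > 0\<close> the contraction
        alone makes the first r entries absorb r + 1.\<close>
      show ?thesis
      proof (cases "i = 0")
        case True
        have "initial_prod G r (contract G (r + s) 0 x) \<in> carrier G"
          by (rule initial_prod_closed [OF c]) simp
        then show ?thesis
          using True 1 2 f1 g1 xk [of 0] initial_prod_contract_0 [OF x, of r, symmetric]
          by (simp add: R_def P_def face_def cup_apply [OF c] G_bilinear_act [OF p]
              act_mult [OF B] act_closed [OF B] del: initial_prod.simps)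
      next
        case False
        then show ?thesis
          using 1 2 that initial_prod_contract [OF x, of r i]
          by (simp add: R_def P_def face_def cup_apply [OF c] del: initial_prod.simps)
      qed
    qed
    \<comment> \<open>A contraction at r + t with \<open>t\<close> positive leaves the first r
      entries alone, so both the argument of \<open>f\<close> and the acting element stay the
      same.\<close>
    show "R (r + t) = Q t" if "1 \<le> t" for t
    proof -
      have 1: "restrict (contract G (r + s) (r + t) x) {..<r} = restrict x {..<r}"
        using that by (auto simp: contract_def fun_eq_iff)
      have 2: "(\<lambda>k\<in>{..<s}. contract G (r + s) (r + t) x (r + k)) = contract G s t ?w"
        using that by (auto simp: contract_def fun_eq_iff)
      show ?thesis
        using 1 2 that initial_prod_contract [OF x, of r "r + t"]
        by (simp add: R_def Q_def face_def cup_apply [OF c])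
    qed
    \<comment> \<open>The middle faces: the last face of \<open>f\<close> drops \<open>x r\<close>,
      which still occurs in the initial product of length r + 1; face 0 of \<open>g\<close> supplies
      it by its action.\<close>
    have 1: "contract G r (Suc r) ?u = restrict x {..<r}"
      by (auto simp: contract_Suc fun_eq_iff)
    have 2: "contract G s 0 ?w = (\<lambda>k\<in>{..<s}. x (Suc r + k))"
      by (auto simp: contract_0 fun_eq_iff)
    have "g (\<lambda>k\<in>{..<s}. x (Suc r + k)) \<in> carrier B"
      by (intro gk shift_in_gtuples xl)
    then show "P (Suc r) = Q 0"
      using 1 2 xk [of r] ir [of r] by (simp add: P_def Q_def face_def act_mult [OF B])
  qed (use P Q in auto)
  ultimately show "?lhs x = (?df \<otimes>\<^bsub>?C\<^esub> signed ?C r ?dg) x"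
    using x dg by (simp add: cochain_signed C.comm_group_axioms)
qed

section \<open>Cup products of cocycles and coboundaries\<close>

lemma signed_in_subgroup:
  "discrete_gmodule G T A \<Longrightarrow> subgroup H (cochains G T r A) \<Longrightarrow> f \<in> H \<Longrightarrow>
    signed (cochains G T r A) n f \<in> H"
  unfolding signed_def by (rule group.subgroup_int_pow_closed [OF group_cochains])

lemma cup_cocycle:
  assumes "discrete_gmodule G T A" "discrete_gmodule G T B" "discrete_gmodule G T C"
    and "G_bilinear G A B C p" "f \<in> cocycles G T r A" "g \<in> cocycles G T s B"
  shows "cup G r s B p f g \<in> cocycles G T (r + s) C"
proof -
  interpret C: comm_group "cochains G T (Suc (r + s)) C"
    by (intro comm_group_cochains discrete_gmodule_comm_group) fact
  have f: "f \<in> carrier (cochains G T r A)" and g: "g \<in> carrier (cochains G T s B)"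
    using assms by (simp_all add: cocycle_cochain)
  have "cup G (Suc r) s B p \<one>\<^bsub>cochains G T (Suc r) A\<^esub> g = \<one>\<^bsub>cochains G T (Suc r + s) C\<^esub>"
    by (rule hom_one [OF cup_hom_left]) (use assms g in \<open>auto intro: group_cochains\<close>)
  moreover have "cup G r (Suc s) B p f \<one>\<^bsub>cochains G T (Suc s) B\<^esub> = \<one>\<^bsub>cochains G T (r + Suc s) C\<^esub>"
    by (rule hom_one [OF cup_hom_right]) (use assms f in \<open>auto intro: group_cochains\<close>)
  ultimately show ?thesis
    using assms(5,6) coboundary_cup [OF assms(1-4) f g] cup_closed [OF assms(2,4) f g]
    by (simp add: cocycles_iff)
qed

text \<open>Since dg is trivial, the Leibniz rule gives du \<union> g = d(u \<union> g). In degree 0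
  the only coboundary is the unit, which the cup product sends to the unit.\<close>

lemma cup_coboundaries_left:
  assumes "discrete_gmodule G T A" "discrete_gmodule G T B" "discrete_gmodule G T C"
    and "G_bilinear G A B C p" "f \<in> coboundaries G T r A" "g \<in> cocycles G T s B"
  shows "cup G r s B p f g \<in> coboundaries G T (r + s) C"
proof (cases r)
  case 0
  have "cup G r s B p \<one>\<^bsub>cochains G T r A\<^esub> g = \<one>\<^bsub>cochains G T (r + s) C\<^esub>"
    by (rule hom_one [OF cup_hom_left]) (use assms in \<open>auto intro: group_cochains cocycle_cochain\<close>)
  then show ?thesis
    using 0 assms(5) subgroup.one_closed [OF subgroup_coboundaries [OF assms(3)]]
    by (simp add: coboundaries_def [of G T 0 A])
next
  case (Suc n)
  interpret C: comm_group "cochains G T (Suc (n + s)) C"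
    by (intro comm_group_cochains discrete_gmodule_comm_group) fact
  obtain u where u: "u \<in> carrier (cochains G T n A)" "f = coboundary G n A u"
    using assms(5) Suc by (auto simp: coboundaries_def)
  have g: "g \<in> carrier (cochains G T s B)" using assms(6) by (rule cocycle_cochain)
  have "cup G n (Suc s) B p u \<one>\<^bsub>cochains G T (Suc s) B\<^esub> = \<one>\<^bsub>cochains G T (n + Suc s) C\<^esub>"
    by (rule hom_one [OF cup_hom_right]) (use assms u in \<open>auto intro: group_cochains\<close>)
  then have "coboundary G (n + s) C (cup G n s B p u g) = cup G r s B p f g"
    using assms(6) coboundary_cup [OF assms(1-4) u(1) g] u(2) Suc
      cup_closed [OF assms(2,4) coboundary_closed [OF assms(1) u(1)] g]
    by (simp add: cocycles_iff)
  then show ?thesis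
    using coboundary_in_coboundaries [OF cup_closed [OF assms(2,4) u(1) g]] Suc by simp
qed

text \<open>Here the Leibniz rule yields d(f \<union> v) = (-1)^r f \<union> dv. The sign is removed
  by applying it once more within the subgroup of coboundaries.\<close>

lemma cup_coboundaries_right:
  assumes "discrete_gmodule G T A" "discrete_gmodule G T B" "discrete_gmodule G T C"
    and "G_bilinear G A B C p" "f \<in> cocycles G T r A" "g \<in> coboundaries G T s B"
  shows "cup G r s B p f g \<in> coboundaries G T (r + s) C"
proof (cases s)
  case 0
  have "cup G r s B p f \<one>\<^bsub>cochains G T s B\<^esub> = \<one>\<^bsub>cochains G T (r + s) C\<^esub>"
    by (rule hom_one [OF cup_hom_right]) (use assms in \<open>auto intro: group_cochains cocycle_cochain\<close>)
  then show ?thesis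
    using 0 assms(6) subgroup.one_closed [OF subgroup_coboundaries [OF assms(3)]]
    by (simp add: coboundaries_def [of G T 0 B])
next
  case (Suc n)
  let ?C = "cochains G T (Suc (r + n)) C"
  interpret C: comm_group ?C
    by (intro comm_group_cochains discrete_gmodule_comm_group) fact
  obtain v where v: "v \<in> carrier (cochains G T n B)" "g = coboundary G n B v"
    using assms(6) Suc by (auto simp: coboundaries_def)
  have f: "f \<in> carrier (cochains G T r A)" using assms(5) by (rule cocycle_cochain)
  have fg: "cup G r s B p f g \<in> carrier ?C"
    using cup_closed [OF assms(2,4) f coboundary_closed [OF assms(2) v(1)]] v(2) Suc by simp
  have "cup G (Suc r) n B p \<one>\<^bsub>cochains G T (Suc r) A\<^esub> v = \<one>\<^bsub>cochains G T (Suc r + n) C\<^esub>"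
    by (rule hom_one [OF cup_hom_left]) (use assms v in \<open>auto intro: group_cochains\<close>)
  then have "coboundary G (r + n) C (cup G r n B p f v) = signed ?C r (cup G r s B p f g)"
    using assms(5) coboundary_cup [OF assms(1-4) f v(1)] v(2) Suc fg
    by (simp add: cocycles_iff)
  then have "signed ?C r (cup G r s B p f g) \<in> coboundaries G T (Suc (r + n)) C"
    using coboundary_in_coboundaries [OF cup_closed [OF assms(2,4) f v(1)]] by simp
  from signed_in_subgroup [OF assms(3) subgroup_coboundaries [OF assms(3)] this, of r] fg
  show ?thesis using Suc by simp
qed

text \<open>The representatives are exchanged one at a time: the coboundary \<open>b\<close> meets
  the cocycle \<open>g'\<close>, the coboundary \<open>c\<close> meets the cocycle
  \<open>f\<close>.\<close>

lemma cohomology_cup_coclass: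
  assumes "discrete_gmodule G T A" "discrete_gmodule G T B" "discrete_gmodule G T C"
    and "G_bilinear G A B C p" "f \<in> cocycles G T r A" "g \<in> cocycles G T s B"
  shows "cohomology_cup G T r s A B C p (coclass G T r A f) (coclass G T s B g)
    = coclass G T (r + s) C (cup G r s B p f g)"
  unfolding cohomology_cup_def
proof (rule the_equality)
  show "\<exists>f' g'. represents G T r A f' (coclass G T r A f) \<and> represents G T s B g' (coclass G T s B g) \<and>
      coclass G T (r + s) C (cup G r s B p f g) = coclass G T (r + s) C (cup G r s B p f' g')"
    using assms(5,6) by (auto simp: represents_def)
  fix \<gamma>
  assume "\<exists>f' g'. represents G T r A f' (coclass G T r A f) \<and>
      represents G T s B g' (coclass G T s B g) \<and>
      \<gamma> = coclass G T (r + s) C (cup G r s B p f' g')"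
  then obtain f' g' where f': "f' \<in> cocycles G T r A" "coclass G T r A f' = coclass G T r A f"
    and g': "g' \<in> cocycles G T s B" "coclass G T s B g' = coclass G T s B g"
    and \<gamma>: "\<gamma> = coclass G T (r + s) C (cup G r s B p f' g')"
    by (auto simp: represents_def)
  note co = assms(5,6) [THEN cocycle_cochain] f'(1) [THEN cocycle_cochain] g'(1) [THEN cocycle_cochain]
  obtain b where b: "b \<in> coboundaries G T r A" "f' = b \<otimes>\<^bsub>cochains G T r A\<^esub> f"
    using coclass_eqE [OF assms(1) co(1,3) f'(2)] .
  obtain c where c: "c \<in> coboundaries G T s B" "g' = c \<otimes>\<^bsub>cochains G T s B\<^esub> g"
    using coclass_eqE [OF assms(2) co(2,4) g'(2)] .
  have "cup G r s B p f' g' = cup G r s B p b g' \<otimes>\<^bsub>cochains G T (r + s) C\<^esub> cup G r s B p f g'"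
    unfolding b(2)
    by (rule hom_mult [OF cup_hom_left [OF assms(1-4) co(4)] coboundaries_cochain [OF assms(1) b(1)] co(1)])
  moreover have "cup G r s B p f g'
      = cup G r s B p f c \<otimes>\<^bsub>cochains G T (r + s) C\<^esub> cup G r s B p f g"
    unfolding c(2)
    by (rule hom_mult [OF cup_hom_right [OF assms(2-4) co(1)] coboundaries_cochain [OF assms(2) c(1)] co(2)])
  ultimately show "\<gamma> = coclass G T (r + s) C (cup G r s B p f g)"
    unfolding \<gamma> using cup_coboundaries_left [OF assms(1-4) b(1) g'(1)]
      cup_coboundaries_right [OF assms(1-5) c(1)] cup_closed [OF assms(2,4)] co
    by (metis coclass_eqI [OF assms(3)])
qed

end

section \<open>Lifting cochains along a short exact sequence\<close>

locale short_exact_structure = topological_group_structure G T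
  for G :: "('g, 'm) monoid_scheme" and T :: "'g topology" +
  fixes A' :: "('g, 'a1) gmodule" and A :: "('g, 'a) gmodule" and A'' :: "('g, 'a2) gmodule"
    and i :: "'a1 \<Rightarrow> 'a" and j :: "'a \<Rightarrow> 'a2"
  assumes short_exact: "short_exact_gmodules G T A' A A'' i j"
begin

lemma modules:
  "discrete_gmodule G T A'" "discrete_gmodule G T A" "discrete_gmodule G T A''"
  using short_exact by (auto simp: short_exact_gmodules_def)

lemma gmodule_homs: "i \<in> gmodule_hom G A' A" "j \<in> gmodule_hom G A A''"
  using short_exact by (auto simp: short_exact_gmodules_def)

lemmas homs = gmodule_homs [THEN gmodule_hom_hom]

lemma inj_i: "inj_on i (carrier A')"
  using short_exact by (auto simp: short_exact_gmodules_def mon_def)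

lemma surj_j: "j ` carrier A = carrier A''"
  using short_exact by (auto simp: short_exact_gmodules_def epi_def)

lemma j_eq_one_iff: "a \<in> carrier A \<Longrightarrow> j a = \<one>\<^bsub>A''\<^esub> \<longleftrightarrow> a \<in> i ` carrier A'"
  using short_exact by (auto simp: short_exact_gmodules_def kernel_def)

text \<open>This turns the identification of \<open>A'\<close>-valued cochains with a kernel into a
  method: equations over \<open>A'\<close> are checked after passing to \<open>A\<close>.\<close>

lemma push_i_inject:
  assumes "e \<in> carrier (cochains G T r A')" "e' \<in> carrier (cochains G T r A')"
    and "push G r i e = push G r i e'"
  shows "e = e'"
proof (rule cochain_eqI [OF assms(1,2)])
  fix x assume x: "x \<in> gtuples G r"
  then have "i (e x) = i (e' x)" using fun_cong [OF assms(3), of x] by simp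
  then show "e x = e' x"
    using inj_i assms(1,2) x by (auto simp: cochain_closed dest: inj_onD)
qed

lemma push_j_push_i:
  assumes "e \<in> carrier (cochains G T r A')"
  shows "push G r j (push G r i e) = \<one>\<^bsub>cochains G T r A''\<^esub>"
proof (rule cochain_eqI [where r = r and A = A''])
  fix x assume x: "x \<in> gtuples G r"
  with assms have "e x \<in> carrier A'" by (simp add: cochain_closed)
  then have "j (i (e x)) = \<one>\<^bsub>A''\<^esub>"
    by (subst j_eq_one_iff) (auto intro: hom_in_carrier [OF homs(1)])
  then show "push G r j (push G r i e) x = \<one>\<^bsub>cochains G T r A''\<^esub> x" using x by simp
qed (intro push_closed [OF homs(2)] push_closed [OF homs(1)] assms cochain_one_closed modules)+

lemma
  assumes f: "f \<in> carrier (cochains G T r A)" and "push G r j f = \<one>\<^bsub>cochains G T r A''\<^esub>"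
  shows pull_closed: "pull G r A' i f \<in> carrier (cochains G T r A')"
    and push_pull: "push G r i (pull G r A' i f) = f"
proof -
  have im: "f x \<in> i ` carrier A'" if "x \<in> gtuples G r" for x
    using fun_cong [OF assms(2), of x] that j_eq_one_iff [OF cochain_closed [OF f that]] by simp
  \<comment> \<open>Continuity is obtained for a map defined on all of \<open>A\<close>, so a value
    off the image of \<open>i\<close> must be supplied; the unit serves, and it is never reached on
    tuples.\<close>
  let ?h = "\<lambda>a. if a \<in> i ` carrier A' then inv_into (carrier A') i a else \<one>\<^bsub>A'\<^esub>"
  interpret A': comm_group A' using modules(1) by (rule discrete_gmodule_comm_group)
  have "continuous_map (tuples_topology r) (discrete_topology (carrier A')) (\<lambda>x. ?h (f x))"
    by (rule continuous_map_discrete_fun [OF cochain_continuous [OF f]]) (simp add: inv_into_into)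
  from restrict_in_cochains [OF this]
  show cl: "pull G r A' i f \<in> carrier (cochains G T r A')"
    unfolding pull_def compose_def using im
    by (simp cong: restrict_cong)
  show "push G r i (pull G r A' i f) = f"
    by (rule cochain_eqI [OF push_closed [OF homs(1) cl] f])
      (simp add: pull_def compose_eq f_inv_into_f im)
qed

text \<open>Discreteness of \<open>A''\<close> makes any section of \<open>j\<close> continuous; it
  need be neither additive nor equivariant.\<close>

lemma lift_cochain:
  assumes "k \<in> carrier (cochains G T r A'')"
  obtains f where "f \<in> carrier (cochains G T r A)" "push G r j f = k"
proof -
  let ?f = "\<lambda>x\<in>gtuples G r. inv_into (carrier A) j (k x)"
  have f: "?f \<in> carrier (cochains G T r A)"
    by (rule restrict_in_cochains [OF continuous_map_discrete_fun [OF cochain_continuous [OF assms]]])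
      (simp add: inv_into_into surj_j)
  have "push G r j ?f = k"
    by (rule cochain_eqI [OF push_closed [OF homs(2) f] assms])
      (simp add: f_inv_into_f surj_j cochain_closed [OF assms])
  with f that show ?thesis by blast
qed

text \<open>It is the bounding cochain \<open>u\<close> that is lifted; its coboundary then lies
  over \<open>k\<close> because \<open>push\<close> commutes with coboundaries.\<close>

lemma lift_coboundaries:
  assumes "k \<in> coboundaries G T r A''"
  obtains f where "f \<in> coboundaries G T r A" "push G r j f = k"
proof (cases r)
  case 0
  have "push G r j \<one>\<^bsub>cochains G T r A\<^esub> = \<one>\<^bsub>cochains G T r A''\<^esub>"
    by (intro push_one modules homs)
  then show ?thesis using that 0 assms by (simp add: coboundaries_def)
next
  case (Suc n)
  then obtain u where u: "u \<in> carrier (cochains G T n A'')" "k = coboundary G n A'' u"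
    using assms by (auto simp: coboundaries_def)
  obtain v where v: "v \<in> carrier (cochains G T n A)" "push G n j v = u"
    using lift_cochain [OF u(1)] .
  show ?thesis
    using that [of "coboundary G n A v"] coboundary_in_coboundaries [OF v(1)]
      push_coboundary [OF modules(2,3) gmodule_homs(2) v(1)] u v Suc by simp
qed

section \<open>The connecting homomorphism on cochains\<close>

definition lifts :: "nat \<Rightarrow> ((nat \<Rightarrow> 'g) \<Rightarrow> 'a) set" where
  "lifts r = {f \<in> carrier (cochains G T r A). push G r j f \<in> cocycles G T r A''}"

text \<open>The snake construction before passing to classes: df, regarded as a cochain with values
  in \<open>A'\<close>.\<close>

definition conn :: "nat \<Rightarrow> ((nat \<Rightarrow> 'g) \<Rightarrow> 'a) \<Rightarrow> (nat \<Rightarrow> 'g) \<Rightarrow> 'a1" where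
  "conn r f = pull G (Suc r) A' i (coboundary G r A f)"

lemma lifts_cochain: "f \<in> lifts r \<Longrightarrow> f \<in> carrier (cochains G T r A)"
  by (simp add: lifts_def)

lemma
  assumes f: "f \<in> lifts r"
  shows push_conn: "push G (Suc r) i (conn r f) = coboundary G r A f"
    and conn_cocycle: "conn r f \<in> cocycles G T (Suc r) A'"
proof -
  have fc: "f \<in> carrier (cochains G T r A)" using f by (rule lifts_cochain)
  note df = coboundary_closed [OF modules(2) fc]
  have "push G (Suc r) j (coboundary G r A f) = \<one>\<^bsub>cochains G T (Suc r) A''\<^esub>"
    using push_coboundary [OF modules(2,3) gmodule_homs(2) fc] f
    by (simp add: lifts_def cocycles_iff)
  note pp = pull_closed [OF df this] push_pull [OF df this]
  show eq: "push G (Suc r) i (conn r f) = coboundary G r A f"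
    using pp(2) by (simp add: conn_def)
  have cl: "conn r f \<in> carrier (cochains G T (Suc r) A')" using pp(1) by (simp add: conn_def)
  \<comment> \<open>After \<open>i\<close> is applied, the coboundary of \<open>conn r f\<close> is
    ddf. It is trivial in \<open>A\<close>, and injectivity of \<open>i\<close> brings this back to
    \<open>A'\<close>.\<close>
  have "push G (Suc (Suc r)) i (coboundary G (Suc r) A' (conn r f)) = \<one>\<^bsub>cochains G T (Suc (Suc r)) A\<^esub>"
    using push_coboundary [OF modules(1,2) gmodule_homs(1) cl] eq
      coboundary_coboundary [OF modules(2) fc] by simp
  also have "\<dots> = push G (Suc (Suc r)) i \<one>\<^bsub>cochains G T (Suc (Suc r)) A'\<^esub>"
    by (intro push_one [symmetric] modules homs)
  finally have "coboundary G (Suc r) A' (conn r f) = \<one>\<^bsub>cochains G T (Suc (Suc r)) A'\<^esub>"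
    by (rule push_i_inject [rotated 2])
      (intro coboundary_closed modules cl cochain_one_closed)+
  then show "conn r f \<in> cocycles G T (Suc r) A'" using cl by (simp add: cocycles_iff)
qed

lemma conn_closed: "f \<in> lifts r \<Longrightarrow> conn r f \<in> carrier (cochains G T (Suc r) A')"
  by (intro cocycle_cochain conn_cocycle)

text \<open>Since \<open>i\<close> is injective, \<open>conn\<close> is determined by its image in
  \<open>A\<close>; computations with it need not unfold the chosen inverse of
  \<open>i\<close>.\<close>

lemma conn_eqI:
  assumes "f \<in> lifts r" "e \<in> carrier (cochains G T (Suc r) A')"
    and "push G (Suc r) i e = coboundary G r A f"
  shows "conn r f = e"
  using push_i_inject [OF conn_closed [OF assms(1)] assms(2)] push_conn [OF assms(1)] assms(3)
  by simp

lemma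
  assumes "f \<in> lifts r" "f' \<in> lifts r"
  shows lifts_mult: "f \<otimes>\<^bsub>cochains G T r A\<^esub> f' \<in> lifts r"
    and conn_mult: "conn r (f \<otimes>\<^bsub>cochains G T r A\<^esub> f')
      = conn r f \<otimes>\<^bsub>cochains G T (Suc r) A'\<^esub> conn r f'"
proof -
  interpret C: group "cochains G T r A" by (intro group_cochains modules)
  interpret D: group "cochains G T (Suc r) A'" by (intro group_cochains modules)
  note f = assms [THEN lifts_cochain]
  show 1: "f \<otimes>\<^bsub>cochains G T r A\<^esub> f' \<in> lifts r"
    using assms subgroup.m_closed [OF subgroup_cocycles [OF modules(3)]]
    by (simp add: lifts_def hom_mult [OF push_hom [OF modules(2,3) homs(2)]])
  show "conn r (f \<otimes>\<^bsub>cochains G T r A\<^esub> f') = conn r f \<otimes>\<^bsub>cochains G T (Suc r) A'\<^esub> conn r f'"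
    using assms f
    by (intro conn_eqI 1 D.m_closed conn_closed)
      (simp_all add: hom_mult [OF push_hom [OF modules(1,2) homs(1)]] conn_closed push_conn
        hom_mult [OF coboundary_hom [OF modules(2)]])
qed

lemma
  assumes "f \<in> cocycles G T r A"
  shows cocycle_lifts: "f \<in> lifts r"
    and conn_of_cocycle: "conn r f = \<one>\<^bsub>cochains G T (Suc r) A'\<^esub>"
proof -
  show 1: "f \<in> lifts r"
    using assms push_cocycle [OF modules(2,3) gmodule_homs(2)] by (simp add: lifts_def cocycles_iff)
  have "push G (Suc r) i \<one>\<^bsub>cochains G T (Suc r) A'\<^esub> = \<one>\<^bsub>cochains G T (Suc r) A\<^esub>"
    by (intro push_one modules homs)
  then show "conn r f = \<one>\<^bsub>cochains G T (Suc r) A'\<^esub>"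
    using assms by (intro conn_eqI 1 cochain_one_closed modules)
      (simp add: cocycles_iff)
qed

text \<open>Such a cochain lies over the trivial cocycle and so is a lift, although \<open>e\<close>
  itself is an arbitrary cochain. This is the ambiguity of a lift over a fixed cocycle.\<close>

lemma
  assumes "e \<in> carrier (cochains G T r A')"
  shows push_i_lifts: "push G r i e \<in> lifts r"
    and conn_push_i: "conn r (push G r i e) = coboundary G r A' e"
proof -
  show 1: "push G r i e \<in> lifts r"
    using push_j_push_i [OF assms] push_closed [OF homs(1) assms]
      subgroup.one_closed [OF subgroup_cocycles [OF modules(3)]] by (simp add: lifts_def)
  show "conn r (push G r i e) = coboundary G r A' e"
    using push_coboundary [OF modules(1,2) gmodule_homs(1) assms]
    by (intro conn_eqI 1 coboundary_closed modules assms)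
qed

lemma lifts_cohomologyE:
  assumes "\<alpha> \<in> carrier (cohomology G T r A'')"
  obtains f where "f \<in> lifts r" "\<alpha> = coclass G T r A'' (push G r j f)"
proof -
  obtain k where k: "k \<in> cocycles G T r A''" "\<alpha> = coclass G T r A'' k"
    using cohomologyE [OF assms] .
  obtain f where "f \<in> carrier (cochains G T r A)" "push G r j f = k"
    using lift_cochain [OF cocycle_cochain [OF k(1)]] .
  with k that [of f] show ?thesis by (simp add: lifts_def)
qed

text \<open>The images under \<open>j\<close> differ by a coboundary \<open>k\<close>. Lifting
  \<open>k\<close> to a coboundary \<open>b\<close> of \<open>A\<close> and dividing f' by both
  \<open>b\<close> and \<open>f\<close> leaves a cochain killed by \<open>j\<close>, hence one that
  comes from \<open>A'\<close>.\<close>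

lemma lifts_eqE:
  assumes f: "f \<in> lifts r" and f': "f' \<in> lifts r"
    and "coclass G T r A'' (push G r j f') = coclass G T r A'' (push G r j f)"
  obtains b e where "b \<in> coboundaries G T r A" "e \<in> carrier (cochains G T r A')"
    "f' = b \<otimes>\<^bsub>cochains G T r A\<^esub> (push G r i e \<otimes>\<^bsub>cochains G T r A\<^esub> f)"
proof -
  let ?A = "cochains G T r A" and ?A'' = "cochains G T r A''"
  interpret A: group ?A by (intro group_cochains modules)
  interpret A'': group ?A'' by (intro group_cochains modules)
  interpret j: group_hom ?A ?A'' "push G r j"
    by unfold_locales (intro push_hom modules homs)
  note fc = lifts_cochain [OF f] lifts_cochain [OF f']
  obtain k where k: "k \<in> coboundaries G T r A''" "push G r j f' = k \<otimes>\<^bsub>?A''\<^esub> push G r j f"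
    using coclass_eqE [OF modules(3) _ _ assms(3)] fc by (metis j.hom_closed)
  obtain b where b: "b \<in> coboundaries G T r A" "push G r j b = k"
    using lift_coboundaries [OF k(1)] .
  have bc: "b \<in> carrier ?A" using modules(2) b(1) by (rule coboundaries_cochain)
  let ?h = "inv\<^bsub>?A\<^esub> b \<otimes>\<^bsub>?A\<^esub> (f' \<otimes>\<^bsub>?A\<^esub> inv\<^bsub>?A\<^esub> f)"
  have h: "?h \<in> carrier ?A" using fc bc by simp
  have "k \<in> carrier ?A''" using b(2) bc by auto
  then have "push G r j ?h = \<one>\<^bsub>?A''\<^esub>"
    using fc bc k(2) b(2) by (simp add: A''.m_assoc)
  note pp = pull_closed [OF h this] push_pull [OF h this]
  have "f' = b \<otimes>\<^bsub>?A\<^esub> (?h \<otimes>\<^bsub>?A\<^esub> f)"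
    using fc bc by (simp add: A.m_assoc) (simp add: A.m_assoc [symmetric])
  with that [OF b(1) pp(1)] pp(2) show ?thesis by simp
qed

text \<open>In the decomposition of another lift, \<open>b\<close> is a cocycle and has trivial
  \<open>conn\<close>, while \<open>e\<close> contributes its own coboundary in
  \<open>A'\<close>.\<close>

lemma connecting_coclass:
  assumes f: "f \<in> lifts r"
  shows "connecting G T r A' A A'' i j (coclass G T r A'' (push G r j f))
    = coclass G T (Suc r) A' (conn r f)"
  unfolding connecting_def conn_def [symmetric]
proof (rule the_equality)
  show "\<exists>f'\<in>carrier (cochains G T r A).
      represents G T r A'' (push G r j f') (coclass G T r A'' (push G r j f)) \<and>
      coclass G T (Suc r) A' (conn r f) = coclass G T (Suc r) A' (conn r f')"
    using f by (auto simp: represents_def lifts_def)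
  fix \<gamma>
  assume "\<exists>f'\<in>carrier (cochains G T r A).
      represents G T r A'' (push G r j f') (coclass G T r A'' (push G r j f)) \<and>
      \<gamma> = coclass G T (Suc r) A' (conn r f')"
  then obtain f' where f': "f' \<in> lifts r"
    "coclass G T r A'' (push G r j f') = coclass G T r A'' (push G r j f)"
    and \<gamma>: "\<gamma> = coclass G T (Suc r) A' (conn r f')"
    by (auto simp: represents_def lifts_def)
  obtain b e where b: "b \<in> coboundaries G T r A" and e: "e \<in> carrier (cochains G T r A')"
    and eq: "f' = b \<otimes>\<^bsub>cochains G T r A\<^esub> (push G r i e \<otimes>\<^bsub>cochains G T r A\<^esub> f)"
    using lifts_eqE [OF f f'] .
  interpret D: group "cochains G T (Suc r) A'" by (intro group_cochains modules)
  have bz: "b \<in> cocycles G T r A" using b coboundaries_subset_cocycles modules(2) by blast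
  have "conn r f' = coboundary G r A' e \<otimes>\<^bsub>cochains G T (Suc r) A'\<^esub> conn r f"
    unfolding eq using f e bz
    by (simp add: conn_mult lifts_mult push_i_lifts cocycle_lifts conn_of_cocycle conn_push_i
        conn_closed coboundary_closed [OF modules(1)])
  then show "\<gamma> = coclass G T (Suc r) A' (conn r f)"
    unfolding \<gamma> using coboundary_in_coboundaries [OF e] conn_closed [OF f]
    by (simp add: coclass_eqI [OF modules(1)])
qed

end

section \<open>The augmented cup product\<close>

locale tate_structure = topological_group_structure G T
  for G :: "('g, 'm) monoid_scheme" and T :: "'g topology" +
  fixes A' :: "('g, 'a1) gmodule" and A :: "('g, 'a) gmodule" and A'' :: "('g, 'a2) gmodule"
    and iA :: "'a1 \<Rightarrow> 'a" and jA :: "'a \<Rightarrow> 'a2"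
    and B' :: "('g, 'b1) gmodule" and B :: "('g, 'b) gmodule" and B'' :: "('g, 'b2) gmodule"
    and iB :: "'b1 \<Rightarrow> 'b" and jB :: "'b \<Rightarrow> 'b2"
    and C :: "('g, 'c) gmodule" and p :: "'a1 \<Rightarrow> 'b \<Rightarrow> 'c" and q :: "'a \<Rightarrow> 'b1 \<Rightarrow> 'c"
  assumes tate: "tate_product G T A' A A'' iA jA B' B B'' iB jB C p q"
begin

sublocale A: short_exact_structure G T A' A A'' iA jA
  using tate by unfold_locales (simp add: tate_product_def)

sublocale B: short_exact_structure G T B' B B'' iB jB
  using tate by unfold_locales (simp add: tate_product_def)

lemma module_C: "discrete_gmodule G T C"
  using tate by (simp add: tate_product_def)

lemma bilinear: "G_bilinear G A' B C p" "G_bilinear G A B' C q"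
  using tate by (simp_all add: tate_product_def)

lemma pairings_agree: "a \<in> carrier A' \<Longrightarrow> b \<in> carrier B' \<Longrightarrow> q (iA a) b = p a (iB b)"
  using tate by (simp add: tate_product_def)

text \<open>Here the agreement of the pairings on \<open>A'\<close> and \<open>B'\<close> enters.
  Equivariance of \<open>iB\<close> is needed as well, to move it past the action of the initial
  product.\<close>

lemma cup_push:
  assumes e: "e \<in> carrier (cochains G T r A')" and h: "h \<in> carrier (cochains G T s B')"
  shows "cup G r s B' q (push G r iA e) h = cup G r s B p e (push G s iB h)"
proof (rule cochain_eqI)
  show "cup G r s B' q (push G r iA e) h \<in> carrier (cochains G T (r + s) C)"
    by (intro cup_closed [OF B.modules(1) bilinear(2)] push_closed [OF A.homs(1)] e h)
  show "cup G r s B p e (push G s iB h) \<in> carrier (cochains G T (r + s) C)"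
    by (intro cup_closed [OF B.modules(2) bilinear(1)] push_closed [OF B.homs(1)] e h)
  fix x assume x: "x \<in> gtuples G (r + s)"
  have "restrict x {..<r} \<in> gtuples G r" "(\<lambda>k\<in>{..<s}. x (r + k)) \<in> gtuples G s"
    using x by (rule restrict_in_gtuples, simp) (rule shift_in_gtuples [OF x])
  moreover have "iB (act B' (initial_prod G r x) b) = act B (initial_prod G r x) (iB b)"
    if "b \<in> carrier B'" for b
    using B.gmodule_homs(1) that initial_prod_closed [OF x, of r] by (simp add: gmodule_hom_def)
  ultimately show "cup G r s B' q (push G r iA e) h x = cup G r s B p e (push G s iB h) x"
    using x by (simp add: cup_apply pairings_agree restrict_closed [OF x e]
        act_shift_closed [OF B.modules(1) x h] cochain_closed [OF h])
qed

text \<open>The cochain whose class \<open>aug_cup\<close> takes, expressed through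
  \<open>conn\<close>. The degree is written \<open>Suc (r + s)\<close>, to which
  \<open>Suc r + s\<close> and \<open>r + Suc s\<close> both simplify.\<close>

definition aug :: "nat \<Rightarrow> nat \<Rightarrow> ((nat \<Rightarrow> 'g) \<Rightarrow> 'a) \<Rightarrow> ((nat \<Rightarrow> 'g) \<Rightarrow> 'b) \<Rightarrow> (nat \<Rightarrow> 'g) \<Rightarrow> 'c" where
  "aug r s f g = cup G (Suc r) s B p (A.conn r f) g
     \<otimes>\<^bsub>cochains G T (Suc (r + s)) C\<^esub>
     signed (cochains G T (Suc (r + s)) C) r (cup G r (Suc s) B' q f (B.conn s g))"

section \<open>The augmented cup product of lifts\<close>

lemma comm_group_C: "comm_group (cochains G T n C)"
  by (rule comm_group_cochains [OF discrete_gmodule_comm_group [OF module_C]])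

lemma cup_conn_closed:
  assumes "f \<in> A.lifts r" "g \<in> B.lifts s"
  shows "cup G (Suc r) s B p (A.conn r f) g \<in> carrier (cochains G T (Suc (r + s)) C)"
    and "cup G r (Suc s) B' q f (B.conn s g) \<in> carrier (cochains G T (Suc (r + s)) C)"
  using cup_closed [OF B.modules(2) bilinear(1) A.conn_closed [OF assms(1)] B.lifts_cochain [OF assms(2)]]
    cup_closed [OF B.modules(1) bilinear(2) A.lifts_cochain [OF assms(1)] B.conn_closed [OF assms(2)]]
  by simp_all

lemma aug_closed:
  assumes "f \<in> A.lifts r" "g \<in> B.lifts s"
  shows "aug r s f g \<in> carrier (cochains G T (Suc (r + s)) C)"
proof -
  interpret C: comm_group "cochains G T (Suc (r + s)) C" by (rule comm_group_C)
  show ?thesis using cup_conn_closed [OF assms] by (simp add: aug_def)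
qed

text \<open>Additivity already holds for cochains, as \<open>conn\<close>, the cup products and the
  sign are all homomorphisms. So the factors in which two lifts differ can be treated
  separately.\<close>

lemma aug_mult_left:
  assumes "f \<in> A.lifts r" "f' \<in> A.lifts r" "g \<in> B.lifts s"
  shows "aug r s (f \<otimes>\<^bsub>cochains G T r A\<^esub> f') g
    = aug r s f g \<otimes>\<^bsub>cochains G T (Suc (r + s)) C\<^esub> aug r s f' g"
proof -
  interpret C: comm_group "cochains G T (Suc (r + s)) C" by (rule comm_group_C)
  note hp = hom_mult [OF cup_hom_left [OF A.modules(1) B.modules(2) module_C bilinear(1)
        B.lifts_cochain [OF assms(3)]] A.conn_closed A.conn_closed]
  note hq = hom_mult [OF cup_hom_left [OF A.modules(2) B.modules(1) module_C bilinear(2)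
        B.conn_closed [OF assms(3)]] A.lifts_cochain A.lifts_cochain]
  show ?thesis
    using assms cup_conn_closed
    by (simp add: aug_def A.conn_mult hp hq C.signed_mult C.m_ac)
qed

lemma aug_mult_right:
  assumes "f \<in> A.lifts r" "g \<in> B.lifts s" "g' \<in> B.lifts s"
  shows "aug r s f (g \<otimes>\<^bsub>cochains G T s B\<^esub> g')
    = aug r s f g \<otimes>\<^bsub>cochains G T (Suc (r + s)) C\<^esub> aug r s f g'"
proof -
  interpret C: comm_group "cochains G T (Suc (r + s)) C" by (rule comm_group_C)
  note hp = hom_mult [OF cup_hom_right [OF B.modules(2) module_C bilinear(1)
        A.conn_closed [OF assms(1)]] B.lifts_cochain B.lifts_cochain]
  note hq = hom_mult [OF cup_hom_right [OF B.modules(1) module_C bilinear(2)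
        A.lifts_cochain [OF assms(1)]] B.conn_closed B.conn_closed]
  show ?thesis
    using assms cup_conn_closed
    by (simp add: aug_def B.conn_mult hp hq C.signed_mult C.m_ac)
qed

text \<open>Serves twice: for a representative of a class of \<open>A\<close> in the first formula,
  and for the coboundary \<open>b\<close> by which two lifts differ.\<close>

lemma aug_cocycle_left:
  assumes "f \<in> cocycles G T r A" "g \<in> B.lifts s"
  shows "aug r s f g = signed (cochains G T (Suc (r + s)) C) r (cup G r (Suc s) B' q f (B.conn s g))"
proof -
  interpret C: comm_group "cochains G T (Suc (r + s)) C" by (rule comm_group_C)
  have "cup G (Suc r) s B p \<one>\<^bsub>cochains G T (Suc r) A'\<^esub> g = \<one>\<^bsub>cochains G T (Suc r + s) C\<^esub>"
    by (rule hom_one [OF cup_hom_left [OF A.modules(1) B.modules(2) module_C bilinear(1)]])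
      (intro B.lifts_cochain assms group_cochains A.modules module_C)+
  then show ?thesis
    using cup_conn_closed(2) [OF A.cocycle_lifts [OF assms(1)] assms(2)]
    by (simp add: aug_def A.conn_of_cocycle [OF assms(1)])
qed

lemma aug_cocycle_right:
  assumes "f \<in> A.lifts r" "g \<in> cocycles G T s B"
  shows "aug r s f g = cup G (Suc r) s B p (A.conn r f) g"
proof -
  interpret C: comm_group "cochains G T (Suc (r + s)) C" by (rule comm_group_C)
  have "cup G r (Suc s) B' q f \<one>\<^bsub>cochains G T (Suc s) B'\<^esub> = \<one>\<^bsub>cochains G T (r + Suc s) C\<^esub>"
    by (rule hom_one [OF cup_hom_right [OF B.modules(1) module_C bilinear(2)]])
      (intro A.lifts_cochain assms group_cochains B.modules module_C)+
  then show ?thesis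
    using cup_conn_closed(1) [OF assms(1) B.cocycle_lifts [OF assms(2)]]
    by (simp add: aug_def B.conn_of_cocycle [OF assms(2)])
qed

lemma aug_push_left:
  assumes e: "e \<in> carrier (cochains G T r A')" and g: "g \<in> B.lifts s"
  shows "aug r s (push G r iA e) g = coboundary G (r + s) C (cup G r s B p e g)"
  using coboundary_cup [OF A.modules(1) B.modules(2) module_C bilinear(1) e B.lifts_cochain [OF g]]
  by (simp add: aug_def A.conn_push_i [OF e] cup_push [OF e B.conn_closed [OF g]] B.push_conn [OF g])

text \<open>The mirror image of the left case with the pairings exchanged: moving
  \<open>iB e\<close> across to the other pairing makes df appear in \<open>A\<close>, and the
  Leibniz rule for \<open>q\<close> applies.\<close>

lemma aug_push_right:
  assumes f: "f \<in> A.lifts r" and e: "e \<in> carrier (cochains G T s B')"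
  shows "aug r s f (push G s iB e) = coboundary G (r + s) C (cup G r s B' q f e)"
  using coboundary_cup [OF A.modules(2) B.modules(1) module_C bilinear(2) A.lifts_cochain [OF f] e]
  by (simp add: aug_def B.conn_push_i [OF e] cup_push [OF A.conn_closed [OF f] e, symmetric]
      A.push_conn [OF f])

section \<open>Independence of the chosen lifts\<close>

lemma coclass_aug_cong_left:
  assumes f: "f \<in> A.lifts r" and f': "f' \<in> A.lifts r" and g: "g \<in> B.lifts s"
    and "coclass G T r A'' (push G r jA f') = coclass G T r A'' (push G r jA f)"
  shows "coclass G T (Suc (r + s)) C (aug r s f' g) = coclass G T (Suc (r + s)) C (aug r s f g)"
proof -
  let ?C = "cochains G T (Suc (r + s)) C" and ?A = "cochains G T r A"
  interpret C: comm_group ?C by (rule comm_group_C)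
  obtain b e where b: "b \<in> coboundaries G T r A" and e: "e \<in> carrier (cochains G T r A')"
    and eq: "f' = b \<otimes>\<^bsub>?A\<^esub> (push G r iA e \<otimes>\<^bsub>?A\<^esub> f)"
    using A.lifts_eqE [OF f f' assms(4)] .
  have bz: "b \<in> cocycles G T r A" using b coboundaries_subset_cocycles A.modules(2) by blast
  note l = A.cocycle_lifts [OF bz] A.push_i_lifts [OF e]
  have "cup G r (Suc s) B' q b (B.conn s g) \<in> coboundaries G T (r + Suc s) C"
    by (rule cup_coboundaries_left [OF A.modules(2) B.modules(1) module_C bilinear(2) b
          B.conn_cocycle [OF g]])
  then have 1: "aug r s b g \<in> coboundaries G T (Suc (r + s)) C"
    unfolding aug_cocycle_left [OF bz g]
    by (intro signed_in_subgroup module_C subgroup_coboundaries) simp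
  have 2: "aug r s (push G r iA e) g \<in> coboundaries G T (Suc (r + s)) C"
    unfolding aug_push_left [OF e g]
    by (intro coboundary_in_coboundaries cup_closed [OF B.modules(2) bilinear(1) e]
        B.lifts_cochain g)
  have "aug r s f' g = aug r s b g \<otimes>\<^bsub>?C\<^esub> (aug r s (push G r iA e) g \<otimes>\<^bsub>?C\<^esub> aug r s f g)"
    unfolding eq using l f g by (simp add: aug_mult_left A.lifts_mult)
  then show ?thesis
    using 1 2 aug_closed l f g by (simp add: coclass_eqI [OF module_C])
qed

text \<open>In the second argument the cocycle \<open>b\<close> leaves df \<union> b without a sign,
  a coboundary because df is a cocycle in \<open>A'\<close>; the part from \<open>B'\<close>
  contributes d(f \<union> e).\<close>

lemma coclass_aug_cong_right:
  assumes f: "f \<in> A.lifts r" and g: "g \<in> B.lifts s" and g': "g' \<in> B.lifts s"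
    and "coclass G T s B'' (push G s jB g') = coclass G T s B'' (push G s jB g)"
  shows "coclass G T (Suc (r + s)) C (aug r s f g') = coclass G T (Suc (r + s)) C (aug r s f g)"
proof -
  let ?C = "cochains G T (Suc (r + s)) C" and ?B = "cochains G T s B"
  interpret C: comm_group ?C by (rule comm_group_C)
  obtain b e where b: "b \<in> coboundaries G T s B" and e: "e \<in> carrier (cochains G T s B')"
    and eq: "g' = b \<otimes>\<^bsub>?B\<^esub> (push G s iB e \<otimes>\<^bsub>?B\<^esub> g)"
    using B.lifts_eqE [OF g g' assms(4)] .
  have bz: "b \<in> cocycles G T s B" using b coboundaries_subset_cocycles B.modules(2) by blast
  note l = B.cocycle_lifts [OF bz] B.push_i_lifts [OF e]
  have "cup G (Suc r) s B p (A.conn r f) b \<in> coboundaries G T (Suc r + s) C"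
    by (rule cup_coboundaries_right [OF A.modules(1) B.modules(2) module_C bilinear(1)
          A.conn_cocycle [OF f] b])
  then have 1: "aug r s f b \<in> coboundaries G T (Suc (r + s)) C"
    unfolding aug_cocycle_right [OF f bz] by simp
  have 2: "aug r s f (push G s iB e) \<in> coboundaries G T (Suc (r + s)) C"
    unfolding aug_push_right [OF f e]
    by (intro coboundary_in_coboundaries cup_closed [OF B.modules(1) bilinear(2)]
        A.lifts_cochain f e)
  have "aug r s f g' = aug r s f b \<otimes>\<^bsub>?C\<^esub> (aug r s f (push G s iB e) \<otimes>\<^bsub>?C\<^esub> aug r s f g)"
    unfolding eq using l f g by (simp add: aug_mult_right B.lifts_mult)
  then show ?thesis
    using 1 2 aug_closed l f g by (simp add: coclass_eqI [OF module_C])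
qed

lemma aug_cup_coclass:
  assumes f: "f \<in> A.lifts r" and g: "g \<in> B.lifts s"
  shows "aug_cup G T r s A' A A'' iA jA B' B B'' iB jB C p q
      (coclass G T r A'' (push G r jA f)) (coclass G T s B'' (push G s jB g))
    = coclass G T (Suc (r + s)) C (aug r s f g)"
proof -
  \<comment> \<open>Stated for arbitrary cochains, because it rewrites beneath the quantifiers of
    the description.\<close>
  have aug_eq: "cup G (Suc r) s B p (pull G (Suc r) A' iA (coboundary G r A f)) g
       \<otimes>\<^bsub>cochains G T (r + s + 1) C\<^esub>
       cup G r (Suc s) B' q f (pull G (Suc s) B' iB (coboundary G s B g))
         [^]\<^bsub>cochains G T (r + s + 1) C\<^esub> ((-1) ^ r :: int) = aug r s f g" for f g
    by (simp add: aug_def A.conn_def B.conn_def signed_def)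
  show ?thesis
    unfolding aug_cup_def aug_eq
  proof (rule the_equality)
    show "\<exists>f'\<in>carrier (cochains G T r A). \<exists>g'\<in>carrier (cochains G T s B).
        represents G T r A'' (push G r jA f') (coclass G T r A'' (push G r jA f)) \<and>
        represents G T s B'' (push G s jB g') (coclass G T s B'' (push G s jB g)) \<and>
        coclass G T (Suc (r + s)) C (aug r s f g) = coclass G T (r + s + 1) C (aug r s f' g')"
      using f g by (intro bexI [of _ f] bexI [of _ g]) (auto simp: A.lifts_def B.lifts_def represents_def)
    fix \<gamma>
    assume "\<exists>f'\<in>carrier (cochains G T r A). \<exists>g'\<in>carrier (cochains G T s B).
        represents G T r A'' (push G r jA f') (coclass G T r A'' (push G r jA f)) \<and>
        represents G T s B'' (push G s jB g') (coclass G T s B'' (push G s jB g)) \<and>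
        \<gamma> = coclass G T (r + s + 1) C (aug r s f' g')"
    then obtain f' g' where f': "f' \<in> A.lifts r"
      "coclass G T r A'' (push G r jA f') = coclass G T r A'' (push G r jA f)"
      and g': "g' \<in> B.lifts s"
      "coclass G T s B'' (push G s jB g') = coclass G T s B'' (push G s jB g)"
      and \<gamma>: "\<gamma> = coclass G T (Suc (r + s)) C (aug r s f' g')"
      by (auto simp: represents_def A.lifts_def B.lifts_def)
    show "\<gamma> = coclass G T (Suc (r + s)) C (aug r s f g)"
      \<comment> \<open>The first lift is exchanged while g' is kept, then the second one with
        \<open>f\<close> already in place.\<close>
      unfolding \<gamma> coclass_aug_cong_left [OF f f'(1) g'(1) f'(2)]
      by (rule coclass_aug_cong_right [OF f g g'])
  qed
qed

section \<open>The two compatibility formulas\<close>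

lemma aug_cup_cohomology_map_left:
  assumes "\<alpha> \<in> carrier (cohomology G T r A)" "\<beta> \<in> carrier (cohomology G T s B'')"
  shows "aug_cup G T r s A' A A'' iA jA B' B B'' iB jB C p q
      (cohomology_map G T r A A'' jA \<alpha>) \<beta>
    = cohomology_cup G T r (Suc s) A B' C q \<alpha> (connecting G T s B' B B'' iB jB \<beta>)
        [^]\<^bsub>cohomology G T (r + s + 1) C\<^esub> ((-1) ^ r :: int)"
proof -
  obtain f where f: "f \<in> cocycles G T r A" "\<alpha> = coclass G T r A f"
    using cohomologyE [OF assms(1)] .
  obtain g where g: "g \<in> B.lifts s" "\<beta> = coclass G T s B'' (push G s jB g)"
    using B.lifts_cohomologyE [OF assms(2)] .
  let ?h = "cup G r (Suc s) B' q f (B.conn s g)"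
  note m = A.modules(2) B.modules(1) module_C bilinear(2)
  \<comment> \<open>Needed for the sign: the class of a power is the power of the class only for a
    cocycle.\<close>
  have h: "?h \<in> cocycles G T (Suc (r + s)) C"
    using cup_cocycle [OF m f(1) B.conn_cocycle [OF g(1)]] by simp
  have "cohomology_cup G T r (Suc s) A B' C q \<alpha> (connecting G T s B' B B'' iB jB \<beta>)
      = coclass G T (Suc (r + s)) C ?h"
    unfolding f(2) g(2) B.connecting_coclass [OF g(1)]
    using cohomology_cup_coclass [OF m f(1) B.conn_cocycle [OF g(1)]] by simp
  moreover have "cohomology_map G T r A A'' jA \<alpha> = coclass G T r A'' (push G r jA f)"
    unfolding f(2) by (rule cohomology_map_coclass [OF A.modules(2,3) A.gmodule_homs(2) f(1)])
  ultimately show ?thesis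
    using aug_cup_coclass [OF A.cocycle_lifts [OF f(1)] g(1)] coclass_int_pow [OF module_C h]
    by (simp add: g(2) aug_cocycle_left [OF f(1) g(1)] signed_def)
qed

text \<open>No sign occurs, because the summand that carries (-1)^r contains dg, which is trivial
  for a cocycle \<open>g\<close>.\<close>

lemma aug_cup_cohomology_map_right:
  assumes "\<alpha> \<in> carrier (cohomology G T r A'')" "\<beta> \<in> carrier (cohomology G T s B)"
  shows "aug_cup G T r s A' A A'' iA jA B' B B'' iB jB C p q
      \<alpha> (cohomology_map G T s B B'' jB \<beta>)
    = cohomology_cup G T (Suc r) s A' B C p (connecting G T r A' A A'' iA jA \<alpha>) \<beta>"
proof -
  obtain f where f: "f \<in> A.lifts r" "\<alpha> = coclass G T r A'' (push G r jA f)"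
    using A.lifts_cohomologyE [OF assms(1)] .
  obtain g where g: "g \<in> cocycles G T s B" "\<beta> = coclass G T s B g"
    using cohomologyE [OF assms(2)] .
  have "cohomology_cup G T (Suc r) s A' B C p (connecting G T r A' A A'' iA jA \<alpha>) \<beta>
      = coclass G T (Suc (r + s)) C (cup G (Suc r) s B p (A.conn r f) g)"
    unfolding f(2) g(2) A.connecting_coclass [OF f(1)]
    using cohomology_cup_coclass [OF A.modules(1) B.modules(2) module_C bilinear(1)
        A.conn_cocycle [OF f(1)] g(1)] by simp
  moreover have "cohomology_map G T s B B'' jB \<beta> = coclass G T s B'' (push G s jB g)"
    unfolding g(2) by (rule cohomology_map_coclass [OF B.modules(2,3) B.gmodule_homs(2) g(1)])
  ultimately show ?thesis
    using aug_cup_coclass [OF f(1) B.cocycle_lifts [OF g(1)]]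
    by (simp add: f(2) aug_cocycle_right [OF f(1) g(1)])
qed

end

theorem proposition4p5:
  fixes G :: "('g, 'm) monoid_scheme" and T :: "'g topology"
    and A' :: "('g, 'a1) gmodule" and A :: "('g, 'a) gmodule" and A'' :: "('g, 'a2) gmodule"
    and iA :: "'a1 \<Rightarrow> 'a" and jA :: "'a \<Rightarrow> 'a2"
    and B' :: "('g, 'b1) gmodule" and B :: "('g, 'b) gmodule" and B'' :: "('g, 'b2) gmodule"
    and iB :: "'b1 \<Rightarrow> 'b" and jB :: "'b \<Rightarrow> 'b2"
    and C :: "('g, 'c) gmodule" and p :: "'a1 \<Rightarrow> 'b \<Rightarrow> 'c" and q :: "'a \<Rightarrow> 'b1 \<Rightarrow> 'c"
    and r s :: nat
  assumes "profinite_group G T"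
    and "tate_product G T A' A A'' iA jA B' B B'' iB jB C p q"
  shows "(\<forall>\<alpha>\<in>carrier (cohomology G T r A). \<forall>\<beta>\<in>carrier (cohomology G T s B'').
            aug_cup G T r s A' A A'' iA jA B' B B'' iB jB C p q
              (cohomology_map G T r A A'' jA \<alpha>) \<beta>
            = cohomology_cup G T r (Suc s) A B' C q \<alpha> (connecting G T s B' B B'' iB jB \<beta>)
                [^]\<^bsub>cohomology G T (r + s + 1) C\<^esub> ((-1) ^ r :: int))
       \<and> (\<forall>\<alpha>\<in>carrier (cohomology G T r A''). \<forall>\<beta>\<in>carrier (cohomology G T s B).
            aug_cup G T r s A' A A'' iA jA B' B B'' iB jB C p q
              \<alpha> (cohomology_map G T s B B'' jB \<beta>)
            = cohomology_cup G T (Suc r) s A' B C p (connecting G T r A' A A'' iA jA \<alpha>) \<beta>)"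
proof -
  interpret tate_structure G T A' A A'' iA jA B' B B'' iB jB C p q
    using assms by unfold_locales (simp_all add: profinite_group_def)
  show ?thesis
    using aug_cup_cohomology_map_left aug_cup_cohomology_map_right by blast
qed

end
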